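(* Let $\Omega\subset\mathbb{R}^N$ be a domain, $p>1$ and $\frac1p+\frac1q=1$. (a) If $\beta\in M_{\Omega,p}(\mathbb{R}^N)$, then there exists an $\Omega$-dependent selfdual Lagrangian $L:\Omega\times\mathbb{R}^N\times\mathbb{R}^N\to\mathbb{R}$ such that $\beta(x,\cdot)=\bar\partial L(x,\cdot)$ for a.e. $x\in\Omega$ and $$C_0(|a|^p+|b|^q-n_0(x))\le L(x,a,b)\le C_1(|a|^p+|b|^q+n_1(x))\qquad\text{for all }a,b\in\mathbb{R}^N,\tag{$*$}$$ where $C_0$ and $C_1$ are two positive constants and $n_0,n_1\in L^1(\Omega)$. (b) Conversely, if $L:\Omega\times\mathbb{R}^N\times\mathbb{R}^N\to\mathbb{R}$ is an $\Omega$-dependent selfdual Lagrangian satisfying $( * )$ (for some positive constants $C_0,C_1$ and some $n_0,n_1\in L^1(\Omega)$), then $\bar\partial L(x,\cdot)\in M_{\Omega,p}(\mathbb{R}^N)$, i.e. the map $(x,\xi)\mapsto\bar\partial L(x,\xi)$ belongs to $M_{\Omega,p}(\mathbb{R}^N)$.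
   Context: $M_{\Omega,p}(\mathbb{R}^N)$ is the class of all possibly multivalued functions $\beta:\Omega\times\mathbb{R}^N\to\mathbb{R}^N$ with closed values such that (i) $\beta$ is measurable with respect to $\mathcal{L}(\Omega)\times\mathcal{B}(\mathbb{R}^N)$ and $\mathcal{B}(\mathbb{R}^N)$, where $\mathcal{L}(\Omega)$ is the $\sigma$-field of all measurable subsets of $\Omega$ and $\mathcal{B}(\mathbb{R}^N)$ the $\sigma$-field of all Borel subsets of $\mathbb{R}^N$; (ii) for a.e. $x\in\Omega$, the map $\beta(x,\cdot)$ is maximal monotone on $\mathbb{R}^N$; (iii) there exist non-negative constants $m_1,m_2,c_1,c_2$ such that for every $\xi\in\mathbb{R}^N$ and $\eta\in\beta(x,\xi)$, $\langle\xi,\eta\rangle\ge\max\{\frac{c_1}{p}|\xi|^p-m_1,\ \frac{c_2}{q}|\eta|^q-m_2\}$. An $\Omega$-dependent selfdual Lagrangian is a function $L:\Omega\times\mathbb{R}^N\times\mathbb{R}^N\to\mathbb{R}\cup\{+\infty\}$, measurable with respect to the $\sigma$-field generated by products of Lebesgue sets in $\Omega$ and Borel sets in $\mathbb{R}^N\times\mathbb{R}^N$, such that for every $x\in\Omega$ the function $L(x,\cdot,\cdot)$ is convex, lower semicontinuous and satisfies $L^*(x,b,a)=L(x,a,b)$ for all $a,b\in\mathbb{R}^N$, where $L^*(x,b,a)=\sup_{\xi,\eta\in\mathbb{R}^N}\{\langle b,\xi\rangle+\langle a,\eta\rangle-L(x,\xi,\eta)\}$. Its vector field is $\bar\partial L(x,a)=\{b\in\mathbb{R}^N:L(x,a,b)=\langle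 a,b\rangle\}$.
   Formalization: In condition (iii) of the class M, c_1 and c_2 are taken strictly positive (not merely non-negative) and m_1, m_2 are non-negative functions in L^1(Ω) instead of constants, the inequality holding for a.e. x; as printed, both (a) and (b) fail. *)

theory Defs
  imports "HOL-Analysis.Analysis"
begin

text \<open>Multivalued maps on \<open>\<real>\<^sup>N\<close> are set-valued functions; empty values are allowed.\<close>

definition monotone_map :: "('v::real_inner \<Rightarrow> 'v set) \<Rightarrow> bool" where
  "monotone_map A \<longleftrightarrow>
     (\<forall>\<xi> \<xi>'. \<forall>\<eta>\<in>A \<xi>. \<forall>\<eta>'\<in>A \<xi>'. 0 \<le> (\<xi> - \<xi>') \<bullet> (\<eta> - \<eta>'))"

definition maximal_monotone_map :: "('v::real_inner \<Rightarrow> 'v set) \<Rightarrow> bool" where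
  "maximal_monotone_map A \<longleftrightarrow> monotone_map A \<and>
     (\<forall>B. monotone_map B \<and> (\<forall>\<xi>. A \<xi> \<subseteq> B \<xi>) \<longrightarrow> B = A)"

text \<open>Measurability of a closed-valued multifunction is meant in the usual sense that the
  inverse image of every closed set is measurable. Closed sets cannot be replaced by Borel sets
  here: \<open>\<L>(\<Omega>) \<otimes> \<B>(\<real>\<^sup>N)\<close> is not complete, and the inverse image of a Borel set under a maximal
  monotone map need not be Borel.\<close>

definition measurable_multimap ::
    "'v::euclidean_space set \<Rightarrow> ('v \<Rightarrow> 'v \<Rightarrow> 'v set) \<Rightarrow> bool" where
  "measurable_multimap \<Omega> \<beta> \<longleftrightarrow>
     (\<forall>C. closed C \<longrightarrow>
        {(x, \<xi>). x \<in> \<Omega> \<and> \<beta> x \<xi> \<inter> C \<noteq> {}} \<in> sets (lebesgue_on \<Omega> \<Otimes>\<^sub>M borel))"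

text \<open>The class \<open>M\<^bsub>\<Omega>,p\<^esub>(\<real>\<^sup>N)\<close>, with \<open>q\<close> the exponent conjugate to \<open>p\<close>. In the coercivity
  condition \<open>c\<^sub>1, c\<^sub>2\<close> are strictly positive and \<open>m\<^sub>1, m\<^sub>2\<close> are non-negative functions in
  \<open>L\<^sup>1(\<Omega>)\<close>, not depending on \<open>\<xi>, \<eta>\<close>. If \<open>c\<^sub>1 = c\<^sub>2 = 0\<close> were admitted, the class would contain the
  zero map, which has no representation by a selfdual Lagrangian of \<open>p\<close>-growth. If \<open>m\<^sub>1, m\<^sub>2\<close> had
  to be constant, then \<open>\<xi> \<mapsto> {\<xi> - t(x)}\<close> with \<open>t\<close> in \<open>L\<^sup>2\<close> but not in \<open>L\<^sup>\<infinity>\<close> (and \<open>p = 2\<close>) would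
  not belong to the class, although it is the vector field of such a Lagrangian with
  integrable \<open>n\<^sub>0, n\<^sub>1\<close>.\<close>

definition M_class ::
    "'v::euclidean_space set \<Rightarrow> real \<Rightarrow> real \<Rightarrow> ('v \<Rightarrow> 'v \<Rightarrow> 'v set) set" where
  "M_class \<Omega> p q = {\<beta>.
     (\<forall>x\<in>\<Omega>. \<forall>\<xi>. closed (\<beta> x \<xi>)) \<and>
     measurable_multimap \<Omega> \<beta> \<and>
     (AE x in lebesgue_on \<Omega>. maximal_monotone_map (\<beta> x)) \<and>
     (\<exists>c1 c2. \<exists>m1 m2 :: 'v \<Rightarrow> real.
        c1 > 0 \<and> c2 > 0 \<and>
        integrable (lebesgue_on \<Omega>) m1 \<and> integrable (lebesgue_on \<Omega>) m2 \<and>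
        (\<forall>x\<in>\<Omega>. 0 \<le> m1 x \<and> 0 \<le> m2 x) \<and>
        (AE x in lebesgue_on \<Omega>. \<forall>\<xi>. \<forall>\<eta>\<in>\<beta> x \<xi>.
           \<xi> \<bullet> \<eta> \<ge> max (c1 / p * norm \<xi> powr p - m1 x) (c2 / q * norm \<eta> powr q - m2 x)))}"

definition ereal_convex :: "('w::real_vector \<Rightarrow> ereal) \<Rightarrow> bool" where
  "ereal_convex f \<longleftrightarrow>
     (\<forall>z w. \<forall>t::real. 0 < t \<and> t < 1 \<longrightarrow>
        f ((1 - t) *\<^sub>R z + t *\<^sub>R w) \<le> ereal (1 - t) * f z + ereal t * f w)"

definition ereal_lsc :: "('w::topological_space \<Rightarrow> ereal) \<Rightarrow> bool" where
  "ereal_lsc f \<longleftrightarrow> (\<forall>z. f z \<le> Liminf (at z) f)"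

text \<open>\<open>Lagrangian_conj L x b a\<close> is \<open>L\<^sup>*(x,b,a)\<close>, the conjugate in the last two variables.\<close>

definition Lagrangian_conj ::
    "('v \<Rightarrow> 'v \<Rightarrow> 'v \<Rightarrow> ereal) \<Rightarrow> 'v \<Rightarrow> 'v::real_inner \<Rightarrow> 'v \<Rightarrow> ereal" where
  "Lagrangian_conj L x b a = (SUP (\<xi>, \<eta>)\<in>UNIV. ereal (b \<bullet> \<xi> + a \<bullet> \<eta>) - L x \<xi> \<eta>)"

definition selfdual_Lagrangian ::
    "'v::euclidean_space set \<Rightarrow> ('v \<Rightarrow> 'v \<Rightarrow> 'v \<Rightarrow> ereal) \<Rightarrow> bool" where
  "selfdual_Lagrangian \<Omega> L \<longleftrightarrow>
     (\<forall>x\<in>\<Omega>. \<forall>a b. L x a b \<noteq> - \<infinity>) \<and>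
     (\<lambda>(x, (a, b)). L x a b) \<in> borel_measurable (lebesgue_on \<Omega> \<Otimes>\<^sub>M (borel :: ('v \<times> 'v) measure)) \<and>
     (\<forall>x\<in>\<Omega>. ereal_convex (\<lambda>(a, b). L x a b) \<and> ereal_lsc (\<lambda>(a, b). L x a b) \<and>
             (\<forall>a b. Lagrangian_conj L x b a = L x a b))"

definition vector_field ::
    "('v \<Rightarrow> 'v \<Rightarrow> 'v \<Rightarrow> ereal) \<Rightarrow> 'v \<Rightarrow> 'v::real_inner \<Rightarrow> 'v set" where
  "vector_field L x a = {b. L x a b = ereal (a \<bullet> b)}"

definition pq_growth ::
    "'v::euclidean_space set \<Rightarrow> real \<Rightarrow> real \<Rightarrow> ('v \<Rightarrow> 'v \<Rightarrow> 'v \<Rightarrow> real) \<Rightarrow> bool" where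
  "pq_growth \<Omega> p q L \<longleftrightarrow>
     (\<exists>C0 C1. \<exists>n0 n1 :: 'v \<Rightarrow> real.
        C0 > 0 \<and> C1 > 0 \<and>
        integrable (lebesgue_on \<Omega>) n0 \<and> integrable (lebesgue_on \<Omega>) n1 \<and>
        (\<forall>x\<in>\<Omega>. \<forall>a b.
           C0 * (norm a powr p + norm b powr q - n0 x) \<le> L x a b \<and>
           L x a b \<le> C1 * (norm a powr p + norm b powr q + n1 x)))"

end

theory Submission
  imports Defs
begin

text \<open>A selfdual Lagrangian is, for each fixed \<open>x\<close>, a real function \<open>l\<close> on pairs \<open>z = (a, b)\<close> that
  equals its own conjugate for the symmetric pairing \<open>\<langle>(a, b), (a', b')\<rangle> = a \<bullet> b' + b \<bullet> a'\<close>. Such an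
  \<open>l\<close> lies above \<open>a \<bullet> b\<close>, and the graph of its vector field is the set where it touches \<open>a \<bullet> b\<close>.

  Every real selfdual \<open>l\<close> grows superlinearly, because it is the conjugate of a finite function.
  So \<open>l\<close> plus a quadratic has a minimiser, and the optimality condition at the minimiser says that
  the resolvent equation of the vector field has a solution (\<open>selfdual_Minty\<close>). Maximality, full
  domain and local boundedness of the vector field follow. This gives (b), apart
  from measurability; that comes from testing \<open>l(\<xi>, \<eta>) - \<xi> \<bullet> \<eta> = 0\<close> on a compact set of \<open>\<eta>\<close> by
  approximate zeros in a countable dense subset.

  For (a), call \<open>h\<close> subdual if \<open>\<langle>z, w\<rangle> \<le> h z + h w\<close>, that is, if \<open>h\<close> dominates its conjugate
  \<open>h\<^sup>*\<close>. Replacing \<open>h\<close> by \<open>(h + h\<^sup>*) / 2\<close> keeps this property, decreases \<open>h\<close> and at least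
  halves the gap \<open>h - h\<^sup>*\<close>. Hence the iteration converges to a selfdual function below \<open>h\<close>
  (\<open>selfdual_selfdual_below\<close>): the functions fall, their conjugates rise, and the common limit is
  its own conjugate.

  For a monotone set \<open>A\<close> that is coercive with exponents \<open>p, q\<close>, a subdual \<open>h\<close> of \<open>p, q\<close>-growth that is
  at most \<open>a \<bullet> b\<close> on \<open>A\<close> is given by a proximal average of the Fitzpatrick function of \<open>A\<close> with the
  function that is \<open>a \<bullet> b\<close> on \<open>A\<close> and \<open>\<infinity>\<close> elsewhere (\<open>prox_mean\<close>). The selfdual function below it
  touches \<open>a \<bullet> b\<close> on all of \<open>A\<close> (\<open>selfdual_extension\<close>). Its upper growth bound passes to a lower
  one by conjugation.

  To make the construction measurable in \<open>x\<close>, it is not applied to the whole graph of \<open>\<beta>(x,\<cdot>)\<close>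
  but to one measurable selection \<open>s\<^sub>d(x) \<in> \<beta>(x,d)\<close>, the element of least norm, for each \<open>d\<close> in a
  countable dense set. Then every infimum and supremum involved can be taken over a countable set.
  Nothing is lost: by \<open>touching_eq_of_dense\<close>, two selfdual functions that touch \<open>a \<bullet> b\<close> over a dense set
  of \<open>d\<close> at common points \<open>(d, s\<^sub>d)\<close> have the same vector field. That \<open>\<beta>(x,\<cdot>)\<close> has nonempty closed
  convex values in the first place follows from the same construction applied to its whole
  graph for a single \<open>x\<close>.\<close>

section \<open>The pairing of phase space and selfdual functions\<close>

definition coupling :: "'v::real_inner \<times> 'v \<Rightarrow> real" where
  "coupling z = fst z \<bullet> snd z"

text \<open>The polarisation of twice the coupling. In this pairing \<open>L\<^sup>*(b, a)\<close> is the conjugate of \<open>L\<close> at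
  \<open>(a, b)\<close>, so that selfduality reads \<open>L\<^sup>* = L\<close>.\<close>

definition dpair :: "'v::real_inner \<times> 'v \<Rightarrow> 'v \<times> 'v \<Rightarrow> real" where
  "dpair z w = fst z \<bullet> snd w + snd z \<bullet> fst w"

lemma dpair_commute: "dpair z w = dpair w z"
  by (simp add: dpair_def inner_commute)

lemma dpair_simps:
  "dpair (z + z') w = dpair z w + dpair z' w" "dpair (z - z') w = dpair z w - dpair z' w"
  "dpair w (z + z') = dpair w z + dpair w z'" "dpair w (z - z') = dpair w z - dpair w z'"
  "dpair (r *\<^sub>R z) w = r * dpair z w" "dpair w (r *\<^sub>R z) = r * dpair w z"
  by (simp_all add: dpair_def inner_simps algebra_simps)

lemma dpair_self: "dpair z z = 2 * coupling z"
  by (simp add: dpair_def coupling_def inner_commute)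

lemma coupling_diff: "coupling (z - w) = coupling z + coupling w - dpair z w"
  by (simp add: dpair_def coupling_def inner_simps inner_commute)

lemma continuous_on_dpair [continuous_intros]:
  "continuous_on S f \<Longrightarrow> continuous_on S g \<Longrightarrow> continuous_on S (\<lambda>x. dpair (f x) (g x))"
  unfolding dpair_def by (intro continuous_intros)

lemma continuous_on_coupling [continuous_intros]:
  "continuous_on S f \<Longrightarrow> continuous_on S (\<lambda>x. coupling (f x))"
  unfolding coupling_def by (intro continuous_intros)

text \<open>Equality of \<open>l\<close> with its conjugate, expressed by saying that \<open>l w\<close> is the least upper bound of
  \<open>dpair z w - l z\<close> over all \<open>z\<close>. This form avoids the arbitrary value of a supremum over an
  unbounded set of reals.\<close>

definition selfdual :: "('v::real_inner \<times> 'v \<Rightarrow> real) \<Rightarrow> bool" where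
  "selfdual l \<longleftrightarrow> (\<forall>z w. dpair z w \<le> l z + l w) \<and>
     (\<forall>w M. (\<forall>z. dpair z w \<le> l z + M) \<longrightarrow> l w \<le> M)"

text \<open>The graph of the vector field of \<open>l\<close>.\<close>

definition touching_set :: "('v::real_inner \<times> 'v \<Rightarrow> real) \<Rightarrow> ('v \<times> 'v) set" where
  "touching_set l = {z. l z = coupling z}"

lemma selfdual_Young: "selfdual l \<Longrightarrow> dpair z w \<le> l z + l w"
  unfolding selfdual_def by blast

lemma selfdual_least: "selfdual l \<Longrightarrow> (\<And>z. dpair z w \<le> l z + M) \<Longrightarrow> l w \<le> M"
  unfolding selfdual_def by blast

lemma selfdual_ge_coupling: "selfdual l \<Longrightarrow> coupling z \<le> l z"
  using selfdual_Young[of l z z] by (simp add: dpair_self)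

text \<open>A supremum of affine functions is convex.\<close>

lemma selfdual_convex:
  assumes "selfdual l"
  shows "convex_on UNIV l"
proof (rule convex_onI)
  fix t :: real and x y assume t: "0 < t" "t < 1"
  show "l ((1 - t) *\<^sub>R x + t *\<^sub>R y) \<le> (1 - t) * l x + t * l y"
  proof (rule selfdual_least[OF assms])
    fix z
    have "(1 - t) * dpair z x \<le> (1 - t) * (l z + l x)" "t * dpair z y \<le> t * (l z + l y)"
      using t selfdual_Young[OF assms] by (intro mult_left_mono; simp)+
    then show "dpair z ((1 - t) *\<^sub>R x + t *\<^sub>R y) \<le> l z + ((1 - t) * l x + t * l y)"
      by (simp add: dpair_simps algebra_simps)
  qed
qed auto

lemma selfdual_continuous:
  fixes l :: "'v::euclidean_space \<times> 'v \<Rightarrow> real"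
  assumes "selfdual l"
  shows "continuous_on UNIV l"
  using convex_on_continuous[OF open_UNIV selfdual_convex[OF assms]] .

lemma touching_monotone:
  assumes "selfdual l" "z \<in> touching_set l" "w \<in> touching_set l"
  shows "0 \<le> coupling (z - w)"
  using selfdual_Young[OF assms(1), of z w] assms(2,3) by (simp add: touching_set_def coupling_diff)

text \<open>Since \<open>l\<close> is finite and continuous, it is bounded on the ball of radius \<open>R\<close>. Testing Young's
  inequality with the point of that ball that pairs with \<open>w\<close> to \<open>R * norm w\<close> gives the bound.\<close>

lemma selfdual_superlinear:
  fixes l :: "'v::euclidean_space \<times> 'v \<Rightarrow> real"
  assumes l: "selfdual l"
  shows "\<exists>M. \<forall>w. R * norm w - M \<le> l w"
proof -
  have "compact (l ` cball 0 \<bar>R\<bar>)"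
    by (intro compact_continuous_image continuous_on_subset[OF selfdual_continuous[OF l]]) auto
  then have "bounded (l ` cball 0 \<bar>R\<bar>)" by (rule compact_imp_bounded)
  then obtain M where M': "\<forall>y\<in>l ` cball 0 \<bar>R\<bar>. norm y \<le> M" unfolding bounded_iff by blast
  have M: "\<bar>l z\<bar> \<le> M" if "norm z \<le> \<bar>R\<bar>" for z
  proof -
    have "l z \<in> l ` cball 0 \<bar>R\<bar>" using that by (intro imageI) simp
    with M' show ?thesis by fastforce
  qed
  have "R * norm w - M \<le> l w" for w
  proof (cases "w = 0")
    case True
    have "\<bar>l 0\<bar> \<le> M" using M[of 0] by simp
    then show ?thesis using True by simp
  next
    case False
    \<comment> \<open>the swap turns the pairing with \<open>w\<close> into the inner product with \<open>w\<close>\<close>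
    define z where "z = (R / norm w) *\<^sub>R prod.swap w"
    have nsw: "norm (prod.swap w) = norm w"
      by (cases w) (simp add: norm_Pair add.commute)
    have "dpair (prod.swap w) w = (norm w)\<^sup>2"
      by (cases w) (simp add: dpair_def norm_Pair power2_norm_eq_inner add.commute)
    then have "dpair z w = R / norm w * (norm w)\<^sup>2"
      by (simp add: z_def dpair_simps)
    then have "dpair z w = R * norm w" using False by (simp add: power2_eq_square)
    moreover have "norm z \<le> \<bar>R\<bar>" using False by (simp add: z_def nsw)
    ultimately show ?thesis using M[of z] selfdual_Young[OF l, of z w] by auto
  qed
  then show ?thesis by blast
qed

lemma nonneg_of_affine_nonneg_near_0:
  fixes a b :: real
  assumes "\<And>t. 0 < t \<Longrightarrow> t < 1 \<Longrightarrow> 0 \<le> a + t * b"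
  shows "0 \<le> a"
proof (rule tendsto_lowerbound)
  show "((\<lambda>t. a + t * b) \<longlongrightarrow> a) (at_right 0)"
    by (auto intro!: tendsto_eq_intros)
  show "\<forall>\<^sub>F t in at_right 0. 0 \<le> a + t * b"
    using assms by (auto simp: eventually_at_right_field intro: exI[of _ 1])
qed simp

text \<open>The resolvent equation is solved by minimising \<open>l - dpair _ z0\<close> plus a quadratic centred at
  \<open>z0 = (a0, b0)\<close>. At a minimiser \<open>zb\<close>, a subgradient of \<open>l\<close> is \<open>w\<close>, so that \<open>l zb + l w \<le> dpair zb w\<close>.
  Both terms on the left dominate the coupling, hence the coupling of \<open>zb - w\<close> is nonpositive. The
  quadratic is chosen so that this coupling is a square; thus \<open>zb = w\<close>, which is the equation, and
  the inequality becomes \<open>l zb = coupling zb\<close>.\<close>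

lemma selfdual_Minty:
  fixes l :: "'v::euclidean_space \<times> 'v \<Rightarrow> real"
  assumes l: "selfdual l" and s: "s > 0"
  shows "\<exists>y. (a0 - s *\<^sub>R y, b0 + y) \<in> touching_set l"
proof -
  define z0 where "z0 = (a0, b0)"
  define Q where "Q = (\<lambda>z. (norm (fst z - a0))\<^sup>2 / (2 * s) + s * (norm (snd z - b0))\<^sup>2 / 2)"
  define f where "f = (\<lambda>z. l z - dpair z z0 + Q z)"
  have Q0: "0 \<le> Q z" for z using s by (simp add: Q_def)
  obtain M where M: "\<And>w. (2 * norm z0 + 1) * norm w - M \<le> l w"
    using selfdual_superlinear[OF l] by blast
  have dp: "dpair z z0 \<le> 2 * norm z0 * norm z" for z
  proof -
    have "dpair z z0 \<le> norm (fst z) * norm (snd z0) + norm (snd z) * norm (fst z0)"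
      unfolding dpair_def by (intro add_mono norm_cauchy_schwarz)
    also have "\<dots> \<le> norm z * norm z0 + norm z * norm z0"
      using norm_fst_le[of "fst z" "snd z"] norm_snd_le[of "snd z" "fst z"]
        norm_fst_le[of "fst z0" "snd z0"] norm_snd_le[of "snd z0" "fst z0"]
      by (intro add_mono mult_mono) auto
    finally show ?thesis by simp
  qed
  have flow: "norm z - M \<le> f z" for z
    using M[of z] dp[of z] Q0[of z] by (simp add: f_def algebra_simps)
  have contf: "continuous_on UNIV f"
    unfolding f_def Q_def
    by (intro continuous_intros selfdual_continuous[OF l]) (use s in auto)
  define R where "R = max 0 (f 0 + M)"
  obtain zb where zb: "zb \<in> cball 0 R" "\<And>z. z \<in> cball 0 R \<Longrightarrow> f zb \<le> f z"
    using continuous_attains_inf[of "cball 0 R" f] continuous_on_subset[OF contf]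
    by (force simp: R_def)
  have min: "f zb \<le> f z" for z
  proof (cases "z \<in> cball 0 R")
    case False
    then have "f 0 \<le> f z" using flow[of z] by (auto simp: R_def)
    then show ?thesis using zb(2)[of 0] by (auto simp: R_def)
  qed (use zb in auto)
  \<comment> \<open>\<open>w - z0\<close> is minus the gradient of \<open>Q\<close> at \<open>zb\<close>, with the components exchanged by the pairing\<close>
  define w where "w = (a0 - s *\<^sub>R (snd zb - b0), b0 - (1 / s) *\<^sub>R (fst zb - a0))"
  have sub: "dpair (z - zb) w \<le> l z - l zb" for z
  proof -
    define d where "d = z - zb"
    \<comment> \<open>divide the minimality inequality at \<open>zb + t d\<close> by \<open>t\<close>\<close>
    have "0 \<le> (l z - l zb - dpair d w) + t * ((norm (fst d))\<^sup>2 / (2 * s) + s * (norm (snd d))\<^sup>2 / 2)"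
      if t: "0 < t" "t < 1" for t
    proof -
      have "l (zb + t *\<^sub>R d) = l ((1 - t) *\<^sub>R zb + t *\<^sub>R z)"
        by (simp add: d_def algebra_simps)
      also have "\<dots> \<le> (1 - t) * l zb + t * l z"
        using convex_onD[OF selfdual_convex[OF l]] t by simp
      finally have 1: "l (zb + t *\<^sub>R d) - l zb \<le> t * (l z - l zb)" by (simp add: algebra_simps)
      have 2: "0 \<le> f (zb + t *\<^sub>R d) - f zb" using min by simp
      have sq: "(norm (x + t *\<^sub>R y))\<^sup>2 = (norm x)\<^sup>2 + t * (2 * (x \<bullet> y)) + t * (t * (norm y)\<^sup>2)" for x y :: 'v
        by (simp add: power2_norm_eq_inner inner_simps inner_commute algebra_simps)
      have 3: "Q (zb + t *\<^sub>R d) - Q zb = t * ((fst zb - a0) \<bullet> fst d / s + s * ((snd zb - b0) \<bullet> snd d)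
          + t * ((norm (fst d))\<^sup>2 / (2 * s) + s * (norm (snd d))\<^sup>2 / 2))"
      proof -
        have e: "fst (zb + t *\<^sub>R d) - a0 = (fst zb - a0) + t *\<^sub>R fst d"
          "snd (zb + t *\<^sub>R d) - b0 = (snd zb - b0) + t *\<^sub>R snd d" by simp_all
        show ?thesis unfolding Q_def e sq using s by (simp add: field_simps)
      qed
      have 4: "dpair d w = dpair d z0 - ((fst zb - a0) \<bullet> fst d / s + s * ((snd zb - b0) \<bullet> snd d))"
        using s by (simp add: dpair_def w_def z0_def inner_simps inner_commute field_simps)
      have "0 \<le> t * (l z - l zb) - t * dpair d z0 + (Q (zb + t *\<^sub>R d) - Q zb)"
        using 1 2 by (simp add: f_def dpair_simps)
      also have "\<dots> = t * ((l z - l zb - dpair d w) + t * ((norm (fst d))\<^sup>2 / (2 * s) + s * (norm (snd d))\<^sup>2 / 2))"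
        unfolding 3 4 by (simp add: algebra_simps)
      finally show ?thesis using t by (simp add: zero_le_mult_iff)
    qed
    then have "0 \<le> l z - l zb - dpair d w" by (rule nonneg_of_affine_nonneg_near_0)
    then show ?thesis by (simp add: d_def)
  qed
  have "l w \<le> dpair zb w - l zb"
  proof (rule selfdual_least[OF l])
    show "dpair z w \<le> l z + (dpair zb w - l zb)" for z
      using sub[of z] by (simp add: dpair_simps)
  qed
  then have "coupling (zb - w) \<le> 0" and lz: "l zb + coupling w \<le> dpair zb w"
    using selfdual_ge_coupling[OF l, of w] selfdual_ge_coupling[OF l, of zb]
    by (auto simp: coupling_diff)
  moreover define u where "u = (fst zb - a0) + s *\<^sub>R (snd zb - b0)"
  have "zb - w = (u, (1 / s) *\<^sub>R u)"
    using s by (cases zb) (simp add: w_def u_def algebra_simps)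
  then have "coupling (zb - w) = (norm u)\<^sup>2 / s"
    by (simp add: coupling_def power2_norm_eq_inner)
  ultimately have "u = 0" using s by (simp add: divide_le_0_iff)
  with \<open>zb - w = _\<close> have "zb - w = (0, 0)" by simp
  then have "zb = w" by (simp flip: zero_prod_def)
  with lz have "l zb = coupling zb" using selfdual_ge_coupling[OF l, of zb] by (simp add: dpair_self)
  then have "zb \<in> touching_set l" by (simp add: touching_set_def)
  moreover have "zb = (a0 - s *\<^sub>R (snd zb - b0), b0 + (snd zb - b0))"
    using \<open>u = 0\<close> by (cases zb) (simp add: u_def algebra_simps eq_neg_iff_add_eq_0)
  ultimately have "(a0 - s *\<^sub>R (snd zb - b0), b0 + (snd zb - b0)) \<in> touching_set l" by (rule back_subst[where P = "\<lambda>x. x \<in> touching_set l"])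
  then show ?thesis by blast
qed

text \<open>Minty's criterion: solve the resolvent equation through \<open>z\<close>; the solution differs from \<open>z\<close> by
  \<open>(- y, y)\<close>, whose coupling is negative unless \<open>y = 0\<close>.\<close>

lemma touching_maximal:
  fixes l :: "'v::euclidean_space \<times> 'v \<Rightarrow> real"
  assumes l: "selfdual l" and mon: "\<And>w. w \<in> touching_set l \<Longrightarrow> 0 \<le> coupling (z - w)"
  shows "z \<in> touching_set l"
proof -
  obtain y where y: "(fst z - 1 *\<^sub>R y, snd z + y) \<in> touching_set l"
    using selfdual_Minty[OF l, of 1 "fst z" "snd z"] by auto
  from mon[OF y] have "y \<bullet> y \<le> 0" by (simp add: coupling_def)
  then have "y = 0" by (metis inner_eq_zero_iff inner_ge_zero order_antisym)
  with y show ?thesis by simp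
qed

lemma closed_touching:
  fixes l :: "'v::euclidean_space \<times> 'v \<Rightarrow> real"
  assumes "selfdual l"
  shows "closed (touching_set l)"
  unfolding touching_set_def
  by (intro closed_Collect_eq selfdual_continuous[OF assms] continuous_intros)

text \<open>The solutions \<open>y\<^sub>k\<close> of the resolvent equation with step \<open>1 / (k + 1)\<close> and right-hand side \<open>a\<close> are bounded
  because \<open>l\<close> is superlinear. Every cluster point of them is a value at \<open>a\<close>.\<close>

lemma touching_full_domain:
  fixes l :: "'v::euclidean_space \<times> 'v \<Rightarrow> real"
  assumes l: "selfdual l"
  shows "\<exists>b. (a, b) \<in> touching_set l"
proof -
  define s :: "nat \<Rightarrow> real" where "s k = inverse (real (Suc k))" for k
  have s: "s k > 0" for k by (simp add: s_def)
  obtain y where y: "\<And>k. (a - s k *\<^sub>R y k, 0 + y k) \<in> touching_set l"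
    using selfdual_Minty[OF l s, where ?a0.0 = a and ?b0.0 = 0] by metis
  obtain M where M: "\<And>w. (norm a + 1) * norm w - M \<le> l w"
    using selfdual_superlinear[OF l] by blast
  have bd: "norm (y k) \<le> M" for k
  proof -
    have "(norm a + 1) * norm (y k) - M \<le> (norm a + 1) * norm (a - s k *\<^sub>R y k, y k) - M"
      using norm_snd_le[of "y k" "a - s k *\<^sub>R y k"] by (simp add: mult_left_mono)
    also have "\<dots> \<le> (a - s k *\<^sub>R y k) \<bullet> y k"
      using M[of "(a - s k *\<^sub>R y k, y k)"] y[of k] by (simp add: touching_set_def coupling_def)
    also have "\<dots> \<le> a \<bullet> y k" using s[of k] by (simp add: inner_simps)
    also have "\<dots> \<le> norm a * norm (y k)" by (rule norm_cauchy_schwarz)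
    finally show ?thesis by (simp add: algebra_simps)
  qed
  then have "bounded (range y)" by (auto simp: bounded_iff)
  then obtain b r where r: "strict_mono r" "(y \<circ> r) \<longlonglongrightarrow> b"
    using bounded_imp_convergent_subsequence by blast
  have "s \<longlonglongrightarrow> 0" unfolding s_def by (rule LIMSEQ_inverse_real_of_nat)
  then have "(s \<circ> r) \<longlonglongrightarrow> 0" using r(1) by (rule LIMSEQ_subseq_LIMSEQ)
  then have "(\<lambda>k. (a - (s \<circ> r) k *\<^sub>R (y \<circ> r) k, (y \<circ> r) k)) \<longlonglongrightarrow> (a - 0 *\<^sub>R b, b)"
    by (intro tendsto_intros r)
  then have "(a - 0 *\<^sub>R b, b) \<in> touching_set l"
    by (rule closed_sequentially[OF closed_touching[OF l], rotated]) (use y in simp)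
  then show ?thesis by auto
qed

lemma touching_locally_bounded:
  fixes l :: "'v::euclidean_space \<times> 'v \<Rightarrow> real"
  assumes l: "selfdual l"
  shows "\<exists>M. \<forall>a b. norm a \<le> R \<longrightarrow> (a, b) \<in> touching_set l \<longrightarrow> norm b \<le> M"
proof -
  obtain M where M: "\<And>w. (\<bar>R\<bar> + 1) * norm w - M \<le> l w"
    using selfdual_superlinear[OF l] by blast
  have "norm b \<le> M" if "norm a \<le> R" "(a, b) \<in> touching_set l" for a b
  proof -
    have "(\<bar>R\<bar> + 1) * norm b - M \<le> (\<bar>R\<bar> + 1) * norm (a, b) - M"
      using norm_snd_le[of b a] by (simp add: mult_left_mono)
    also have "\<dots> \<le> a \<bullet> b"
      using M[of "(a, b)"] that(2) by (simp add: touching_set_def coupling_def)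
    also have "\<dots> \<le> norm a * norm b" by (rule norm_cauchy_schwarz)
    also have "\<dots> \<le> \<bar>R\<bar> * norm b" using that(1) by (intro mult_right_mono) auto
    finally show ?thesis by (simp add: algebra_simps)
  qed
  then show ?thesis by blast
qed

text \<open>A point \<open>z\<close> of the second graph is compared with a point \<open>w\<close> of the first one through a point
  \<open>(u, b)\<close> over the midpoint \<open>u\<close> of their first components, obtained as a limit of the common points.
  By closedness \<open>(u, b)\<close> belongs to both graphs, so \<open>z - (u, b)\<close> and \<open>(u, b) - w\<close> both have nonnegative
  coupling. Their first components are equal, and adding the second components
  gives the monotone relation between \<open>z\<close> and \<open>w\<close>.\<close>

lemma touching_eq_of_dense:
  fixes l l' :: "'v::euclidean_space \<times> 'v \<Rightarrow> real"
  assumes l: "selfdual l" and l': "selfdual l'"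
    and D: "closure D = UNIV"
    and s: "\<And>d. d \<in> D \<Longrightarrow> (d, s d) \<in> touching_set l \<inter> touching_set l'"
  shows "touching_set l' = touching_set l"
proof -
  have sub: "z \<in> touching_set l" if z: "z \<in> touching_set l'" for z
  proof (rule touching_maximal[OF l])
    fix w assume w: "w \<in> touching_set l"
    define u where "u = (1/2) *\<^sub>R (fst z + fst w)"
    have "u \<in> closure D" using D by simp
    then obtain e where e: "\<And>n. e n \<in> D" "e \<longlonglongrightarrow> u" by (auto simp: closure_sequential)
    obtain R where R: "\<And>n. norm (e n) \<le> R"
      using convergent_imp_bounded[OF e(2)] by (auto simp: bounded_iff)
    obtain M where "\<And>a b. norm a \<le> R \<Longrightarrow> (a, b) \<in> touching_set l \<Longrightarrow> norm b \<le> M"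
      using touching_locally_bounded[OF l] by blast
    then have "bounded (range (s \<circ> e))" using R s e(1) by (force simp: bounded_iff)
    then obtain b r where r: "strict_mono r" "((s \<circ> e) \<circ> r) \<longlonglongrightarrow> b"
      using bounded_imp_convergent_subsequence by blast
    have lim: "(\<lambda>n. ((e \<circ> r) n, ((s \<circ> e) \<circ> r) n)) \<longlonglongrightarrow> (u, b)"
      by (intro tendsto_intros r LIMSEQ_subseq_LIMSEQ[OF e(2)])
    have "(u, b) \<in> touching_set l" "(u, b) \<in> touching_set l'"
      by (rule closed_sequentially[OF closed_touching[OF l] _ lim]
               closed_sequentially[OF closed_touching[OF l'] _ lim], use s e(1) in simp)+
    then have "0 \<le> coupling (z - (u, b))" "0 \<le> coupling ((u, b) - w)"
      using touching_monotone l l' z w by blast+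
    then have "0 \<le> (fst z - u) \<bullet> (snd z - b)" "0 \<le> (u - fst w) \<bullet> (b - snd w)"
      by (simp_all add: coupling_def)
    moreover have "fst z - u = (1/2) *\<^sub>R (fst z - fst w)" "u - fst w = (1/2) *\<^sub>R (fst z - fst w)"
      by (simp_all add: u_def vec_eq_iff algebra_simps flip: scaleR_add_left)
    ultimately have "0 \<le> (fst z - fst w) \<bullet> ((snd z - b) + (b - snd w))"
      unfolding inner_add_right by simp
    then show "0 \<le> coupling (z - w)" by (simp add: coupling_def)
  qed
  moreover have "z \<in> touching_set l'" if "z \<in> touching_set l" for z
    by (rule touching_maximal[OF l']) (use sub that touching_monotone[OF l] in blast)
  ultimately show ?thesis by blast
qed

section \<open>Selfdual functions below subdual ones\<close>

text \<open>Equivalently, \<open>h\<close> dominates its conjugate.\<close>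

definition subdual :: "('v::real_inner \<times> 'v \<Rightarrow> real) \<Rightarrow> bool" where
  "subdual h \<longleftrightarrow> (\<forall>z w. dpair z w \<le> h z + h w)"

text \<open>For subdual \<open>h\<close> the supremum is over a bounded set, and it is the conjugate of \<open>h\<close>.\<close>

definition dconj :: "('v::real_inner \<times> 'v \<Rightarrow> real) \<Rightarrow> 'v \<times> 'v \<Rightarrow> real" where
  "dconj h w = (SUP z. dpair z w - h z)"

lemma subdualD: "subdual h \<Longrightarrow> dpair z w \<le> h z + h w"
  unfolding subdual_def by blast

lemma dconj_bdd: "subdual h \<Longrightarrow> bdd_above (range (\<lambda>z. dpair z w - h z))"
  by (rule bdd_aboveI[of _ "h w"]) (use subdualD[of h _ w] in \<open>force simp: algebra_simps\<close>)

lemma dconj_upper: "subdual h \<Longrightarrow> dpair z w \<le> h z + dconj h w"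
  unfolding dconj_def using cSUP_upper[OF UNIV_I dconj_bdd, of h z w] by simp

lemma dconj_least: "(\<And>z. dpair z w \<le> h z + M) \<Longrightarrow> dconj h w \<le> M"
  unfolding dconj_def by (rule cSUP_least) (auto simp: algebra_simps)

lemma dconj_le: "subdual h \<Longrightarrow> dconj h w \<le> h w"
  by (rule dconj_least) (rule subdualD)

lemma dconj_antimono:
  assumes "subdual h'" "\<And>z. h' z \<le> h z"
  shows "dconj h w \<le> dconj h' w"
proof (rule dconj_least)
  show "dpair z w \<le> h z + dconj h' w" for z
    using dconj_upper[OF assms(1), of z w] assms(2)[of z] by simp
qed

lemma dconj_convex:
  assumes h: "subdual h"
  shows "convex_on UNIV (dconj h)"
proof (rule convex_onI)
  fix t :: real and x y assume t: "0 < t" "t < 1"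
  show "dconj h ((1 - t) *\<^sub>R x + t *\<^sub>R y) \<le> (1 - t) * dconj h x + t * dconj h y"
  proof (rule dconj_least)
    fix z
    have "(1 - t) * dpair z x \<le> (1 - t) * (h z + dconj h x)" "t * dpair z y \<le> t * (h z + dconj h y)"
      using t dconj_upper[OF h] by (intro mult_left_mono; simp)+
    then show "dpair z ((1 - t) *\<^sub>R x + t *\<^sub>R y) \<le> h z + ((1 - t) * dconj h x + t * dconj h y)"
      by (simp add: dpair_simps algebra_simps)
  qed
qed auto

lemma dconj_continuous:
  fixes h :: "'v::euclidean_space \<times> 'v \<Rightarrow> real"
  assumes "subdual h"
  shows "continuous_on UNIV (dconj h)"
  using convex_on_continuous[OF open_UNIV dconj_convex[OF assms]] .

primrec dual_mean :: "('v::real_inner \<times> 'v \<Rightarrow> real) \<Rightarrow> nat \<Rightarrow> 'v \<times> 'v \<Rightarrow> real" where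
  "dual_mean h 0 = h"
| "dual_mean h (Suc n) = (\<lambda>z. (dual_mean h n z + dconj (dual_mean h n) z) / 2)"

definition selfdual_below :: "('v::real_inner \<times> 'v \<Rightarrow> real) \<Rightarrow> 'v \<times> 'v \<Rightarrow> real" where
  "selfdual_below h z = lim (\<lambda>n. dual_mean h n z)"

text \<open>Average Young's inequality for the pair \<open>h, h\<^sup>*\<close> at \<open>(z, w)\<close> with the one at \<open>(w, z)\<close>.\<close>

lemma subdual_dual_mean: "subdual h \<Longrightarrow> subdual (dual_mean h n)"
proof (induction n)
  case (Suc n)
  then have s: "subdual (dual_mean h n)" by simp
  have "dpair z w \<le> dual_mean h (Suc n) z + dual_mean h (Suc n) w" for z w
    using dconj_upper[OF s, of z w] dconj_upper[OF s, of w z]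
    unfolding dpair_commute[of w z] by (simp add: field_simps)
  then show ?case unfolding subdual_def by blast
qed simp

lemma dual_mean_decseq:
  assumes "subdual h"
  shows "decseq (\<lambda>n. dual_mean h n z)"
proof (rule decseq_SucI)
  show "dual_mean h (Suc n) z \<le> dual_mean h n z" for n
    using dconj_le[OF subdual_dual_mean[OF assms], of n z] by simp
qed

lemma dual_mean_le: "subdual h \<Longrightarrow> m \<le> n \<Longrightarrow> dual_mean h n z \<le> dual_mean h m z"
  using decseqD[OF dual_mean_decseq] .

text \<open>Against the old conjugate one step halves the gap, and the new conjugate is at least the old one because the
  function has decreased.\<close>

lemma dual_mean_gap:
  assumes h: "subdual h"
  shows "dual_mean h n z - dconj (dual_mean h n) z \<le> (h z - dconj h z) / 2 ^ n"
proof (induction n)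
  case (Suc n)
  have "dconj (dual_mean h n) z \<le> dconj (dual_mean h (Suc n)) z"
    by (intro dconj_antimono subdual_dual_mean h dual_mean_le) auto
  then have "dual_mean h (Suc n) z - dconj (dual_mean h (Suc n)) z
      \<le> (dual_mean h n z - dconj (dual_mean h n) z) / 2" by (simp add: field_simps)
  also have "\<dots> \<le> (h z - dconj h z) / 2 ^ n / 2"
    using Suc by (intro divide_right_mono) auto
  finally show ?case by (simp add: field_simps)
qed simp

lemma dconj_le_dual_mean:
  assumes h: "subdual h"
  shows "dconj (dual_mean h m) z \<le> dual_mean h n z"
proof -
  have "dconj (dual_mean h m) z \<le> dconj (dual_mean h (max m n)) z"
    by (intro dconj_antimono subdual_dual_mean h dual_mean_le) auto
  also have "\<dots> \<le> dual_mean h (max m n) z"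
    by (intro dconj_le subdual_dual_mean h)
  also have "\<dots> \<le> dual_mean h n z" by (intro dual_mean_le h) auto
  finally show ?thesis .
qed

lemma dual_mean_tendsto:
  assumes h: "subdual h"
  shows "(\<lambda>n. dual_mean h n z) \<longlonglongrightarrow> selfdual_below h z"
proof -
  have "dconj (dual_mean h 0) z \<le> dual_mean h n z" for n by (rule dconj_le_dual_mean[OF h])
  then obtain L where "(\<lambda>n. dual_mean h n z) \<longlonglongrightarrow> L"
    using decseq_convergent[OF dual_mean_decseq[OF h]] by metis
  then show ?thesis unfolding selfdual_below_def by (simp add: limI)
qed

lemma selfdual_below_le:
  assumes h: "subdual h"
  shows "selfdual_below h z \<le> h z"
  by (rule LIMSEQ_le_const2[OF dual_mean_tendsto[OF h]])
    (use dual_mean_le[OF h, of 0 _ z] in \<open>simp add: exI[of _ 0]\<close>)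

text \<open>The iterates decrease to the limit \<open>L\<close> while their conjugates stay below \<open>L\<close>. An upper bound for
  the conjugate of \<open>L\<close> at \<open>w\<close> is one for the conjugate of each iterate, and these converge to \<open>L w\<close>
  because the gap tends to zero.\<close>

theorem selfdual_selfdual_below:
  assumes h: "subdual h"
  shows "selfdual (selfdual_below h)"
  unfolding selfdual_def
proof (intro conjI allI impI)
  note lim = dual_mean_tendsto[OF h]
  show "dpair z w \<le> selfdual_below h z + selfdual_below h w" for z w
    by (rule LIMSEQ_le_const[OF tendsto_add[OF lim lim]])
      (intro exI allI impI subdualD subdual_dual_mean h)
  fix w M assume M: "\<forall>z. dpair z w \<le> selfdual_below h z + M"
  have "dual_mean h n w \<le> M + (h w - dconj h w) / 2 ^ n" for n
  proof -
    have le: "selfdual_below h z \<le> dual_mean h n z" for z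
      by (rule LIMSEQ_le_const2[OF lim]) (use dual_mean_le[OF h, of n _ z] in blast)
    have "dpair z w \<le> dual_mean h n z + M" for z
      using M[rule_format, of z] le[of z] by linarith
    then have "dconj (dual_mean h n) w \<le> M" by (rule dconj_least)
    then show ?thesis using dual_mean_gap[OF h, of n w] by simp
  qed
  moreover have "(\<lambda>n. M + (h w - dconj h w) / 2 ^ n) \<longlonglongrightarrow> M + 0"
    by (intro tendsto_intros LIMSEQ_divide_realpow_zero) simp
  ultimately have "selfdual_below h w \<le> M + 0"
    by (intro LIMSEQ_le[OF lim]) auto
  then show "selfdual_below h w \<le> M" by simp
qed

section \<open>Proximal averages of coercive monotone sets\<close>

definition pnorm :: "real \<Rightarrow> real \<Rightarrow> 'v::real_normed_vector \<times> 'v \<Rightarrow> real" where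
  "pnorm p q z = norm (fst z) powr p + norm (snd z) powr q"

text \<open>For conjugate exponents this function equals its conjugate for \<open>dpair\<close>. It takes the place of
  the squared norm that serves as the kernel of the proximal average when \<open>p = 2\<close>.\<close>

definition pq_kernel :: "real \<Rightarrow> real \<Rightarrow> 'v::real_normed_vector \<times> 'v \<Rightarrow> real" where
  "pq_kernel p q z = norm (fst z) powr p / p + norm (snd z) powr q / q"

definition coercive_monotone ::
    "real \<Rightarrow> real \<Rightarrow> real \<Rightarrow> real \<Rightarrow> ('v::real_inner \<times> 'v) set \<Rightarrow> bool" where
  "coercive_monotone p q c m A \<longleftrightarrow>
     (\<forall>z\<in>A. \<forall>w\<in>A. 0 \<le> coupling (z - w)) \<and> (\<forall>z\<in>A. c * pnorm p q z - m \<le> coupling z)"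

text \<open>The conjugate of the function that is the coupling on \<open>A\<close> and \<open>\<infinity>\<close> elsewhere.\<close>

definition fitzpatrick :: "('v::real_inner \<times> 'v) set \<Rightarrow> 'v \<times> 'v \<Rightarrow> real" where
  "fitzpatrick A z = (SUP w\<in>A. dpair z w - coupling w)"

text \<open>The point \<open>z\<close> is the midpoint of \<open>2z - w\<close> and \<open>w\<close>. The bridge is the average of the Fitzpatrick
  function at the first point and of the coupling at the second, plus a penalty for their distance.\<close>

definition bridge :: "real \<Rightarrow> real \<Rightarrow> ('v::real_inner \<times> 'v) set \<Rightarrow> 'v \<times> 'v \<Rightarrow> 'v \<times> 'v \<Rightarrow> real" where
  "bridge p q A z w = fitzpatrick A (2 *\<^sub>R z - w) / 2 + coupling w / 2 + pq_kernel p q (z - w)"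

text \<open>The proximal average of the Fitzpatrick function of \<open>A\<close> and the coupling restricted to \<open>A\<close>.\<close>

definition prox_mean :: "real \<Rightarrow> real \<Rightarrow> ('v::real_inner \<times> 'v) set \<Rightarrow> 'v \<times> 'v \<Rightarrow> real" where
  "prox_mean p q A z = (INF w\<in>A. bridge p q A z w)"

lemma conjugate_exponent_gt_1:
  fixes p q :: real
  assumes "p > 1" and "1 / p + 1 / q = 1"
  shows "q > 1"
proof -
  have "1 / q = 1 - 1 / p" "0 < 1 - 1 / p" "1 - 1 / p < 1" using assms by (auto simp: field_simps)
  then have "0 < 1 / q" "1 / q < 1" by simp_all
  then show ?thesis by (simp add: field_simps split: if_splits)
qed

lemma weighted_Young:
  fixes p q :: real
  assumes p: "p > 1" and pq: "1 / p + 1 / q = 1" and c: "c > 0"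
  shows "\<exists>C>0. \<forall>x\<ge>0. \<forall>y\<ge>0. x * y \<le> c * x powr p + C * y powr q"
proof -
  note q = conjugate_exponent_gt_1[OF p pq]
  define s where "s = (c * p) powr (1 / p)"
  have s: "s > 0" using c p by (simp add: s_def)
  have sp: "s powr p = c * p" using c p by (simp add: s_def powr_powr)
  have "x * y \<le> c * x powr p + (1 / s) powr q / q * y powr q" if "x \<ge> 0" "y \<ge> 0" for x y
  proof -
    have "x * y = (s * x) * (1 / s * y)" using s by simp
    also have "\<dots> \<le> (s * x) powr p / p + (1 / s * y) powr q / q"
      using s that by (intro Youngs_inequality p q pq) auto
    also have "\<dots> = c * x powr p + (1 / s) powr q / q * y powr q"
      using s sp that p by (simp add: powr_mult powr_divide)
    finally show ?thesis .
  qed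
  moreover have "(1 / s) powr q / q > 0" using s q by simp
  ultimately show ?thesis by blast
qed

context
  fixes p q :: real
  assumes p: "p > 1" and pq: "1 / p + 1 / q = 1"
begin

lemma q_gt_1: "q > 1"
  by (rule conjugate_exponent_gt_1[OF p pq])

lemma pnorm_nonneg: "0 \<le> pnorm p q z"
  by (simp add: pnorm_def)

lemma pq_kernel_le_pnorm: "pq_kernel p q z \<le> pnorm p q z"
  using p q_gt_1 by (simp add: pq_kernel_def pnorm_def add_mono divide_le_eq mult_le_cancel_left1)

lemma pq_kernel_Young: "\<bar>dpair z w\<bar> \<le> pq_kernel p q z + pq_kernel p q (w :: 'v::real_inner \<times> 'v)"
proof -
  have "\<bar>dpair z w\<bar> \<le> norm (fst z) * norm (snd w) + norm (fst w) * norm (snd z)"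
    unfolding dpair_def
    using Cauchy_Schwarz_ineq2[of "fst z" "snd w"] Cauchy_Schwarz_ineq2[of "snd z" "fst w"]
    by (simp add: mult.commute)
  also have "\<dots> \<le> pq_kernel p q z + pq_kernel p q w"
    using Youngs_inequality[OF p q_gt_1 pq, of "norm (fst z)" "norm (snd w)"]
      Youngs_inequality[OF p q_gt_1 pq, of "norm (fst w)" "norm (snd z)"]
    by (simp add: pq_kernel_def)
  finally show ?thesis .
qed

lemma coupling_le_pq_kernel: "coupling z \<le> pq_kernel p q (z :: 'v::real_inner \<times> 'v)"
  using pq_kernel_Young[of z z] by (simp add: dpair_self)

lemma pnorm_add_le: "pnorm p q (z + w) \<le> (2 powr p + 2 powr q) * (pnorm p q z + pnorm p q w)"
proof -
  \<comment> \<open>crude, but sufficient: the norm of the sum is at most twice the larger norm\<close>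
  have aux: "norm (x + y) powr r \<le> 2 powr r * (norm x powr r + norm y powr r)"
    if r: "r > 0" for r and x y :: 'a
  proof -
    have "norm (x + y) powr r \<le> (2 * max (norm x) (norm y)) powr r"
      using r norm_triangle_ineq[of x y] by (intro powr_mono2) auto
    also have "\<dots> = 2 powr r * max (norm x) (norm y) powr r" by (simp add: powr_mult)
    also have "\<dots> \<le> 2 powr r * (norm x powr r + norm y powr r)"
      by (intro mult_left_mono) (auto simp: max_def)
    finally show ?thesis .
  qed
  have "pnorm p q (z + w) \<le> 2 powr p * (norm (fst z) powr p + norm (fst w) powr p)
      + 2 powr q * (norm (snd z) powr q + norm (snd w) powr q)"
    unfolding pnorm_def fst_add snd_add using p q_gt_1 by (intro add_mono aux) auto
  also have "\<dots> \<le> (2 powr p + 2 powr q) * (norm (fst z) powr p + norm (fst w) powr p)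
      + (2 powr p + 2 powr q) * (norm (snd z) powr q + norm (snd w) powr q)"
    by (intro add_mono mult_right_mono) auto
  finally show ?thesis by (simp add: pnorm_def algebra_simps)
qed

lemma pnorm_uminus: "pnorm p q (- z) = pnorm p q z"
  by (simp add: pnorm_def)

lemma dpair_le_pnorm:
  assumes c: "c > 0"
  shows "\<exists>C>0. \<forall>z w :: 'v::real_inner \<times> 'v. dpair z w \<le> C * pnorm p q z + c * pnorm p q w"
proof -
  obtain C1 where C1: "C1 > 0" "\<And>x y. x \<ge> 0 \<Longrightarrow> y \<ge> 0 \<Longrightarrow> x * y \<le> c * x powr p + C1 * y powr q"
    using weighted_Young[OF p pq c] by blast
  obtain C2 where C2: "C2 > 0" "\<And>x y. x \<ge> 0 \<Longrightarrow> y \<ge> 0 \<Longrightarrow> x * y \<le> c * x powr q + C2 * y powr p"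
    using weighted_Young[OF q_gt_1 _ c, of p] pq by (auto simp: add.commute)
  have "dpair z w \<le> max C1 C2 * pnorm p q z + c * pnorm p q w" for z w :: "'v \<times> 'v"
  proof -
    have "dpair z w \<le> norm (fst w) * norm (snd z) + norm (snd w) * norm (fst z)"
      unfolding dpair_def
      using norm_cauchy_schwarz[of "fst z" "snd w"] norm_cauchy_schwarz[of "snd z" "fst w"]
      by (simp add: mult.commute)
    also have "\<dots> \<le> (c * norm (fst w) powr p + C1 * norm (snd z) powr q)
        + (c * norm (snd w) powr q + C2 * norm (fst z) powr p)"
      by (intro add_mono C1 C2) auto
    also have "\<dots> \<le> (c * norm (fst w) powr p + max C1 C2 * norm (snd z) powr q)
        + (c * norm (snd w) powr q + max C1 C2 * norm (fst z) powr p)"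
      by (intro add_mono mult_right_mono) auto
    finally show ?thesis by (simp add: pnorm_def algebra_simps)
  qed
  then show ?thesis using C1(1) by (metis less_max_iff_disj)
qed

text \<open>Coercivity absorbs the part of \<open>dpair z w\<close> that depends on \<open>w\<close>. The bound is stated for the single terms
  because it also has to show that their supremum, the Fitzpatrick function, is over a bounded set.\<close>

lemma fitzpatrick_terms_le:
  assumes c: "c > 0"
  shows "\<exists>C>0. \<forall>(A :: ('v::real_inner \<times> 'v) set) m z. coercive_monotone p q c m A \<longrightarrow>
    (\<forall>w\<in>A. dpair z w - coupling w \<le> C * pnorm p q z + m)"
proof -
  obtain C where C: "C > 0" "\<And>z w :: 'v \<times> 'v. dpair z w \<le> C * pnorm p q z + c * pnorm p q w"
    using dpair_le_pnorm[OF c] by blast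
  have "dpair z w - coupling w \<le> C * pnorm p q z + m"
    if "coercive_monotone p q c m A" "w \<in> A" for A m and z w :: "'v \<times> 'v"
  proof -
    have "c * pnorm p q w - m \<le> coupling w"
      using that unfolding coercive_monotone_def by blast
    with C(2)[of z w] show ?thesis by linarith
  qed
  with C(1) show ?thesis by blast
qed

text \<open>Young's inequality is tested at \<open>w = (t|b|\<^bsup>q-2\<^esup>b, t|a|\<^bsup>p-2\<^esup>a)\<close> for \<open>z = (a, b)\<close>, so that
  \<open>dpair z w = t * pnorm p q z\<close>. For small \<open>t\<close> the upper bound for \<open>l w\<close> takes away at most
  half of this, because \<open>t\<^sup>p\<close> and \<open>t\<^sup>q\<close> are of smaller order than \<open>t\<close>.\<close>

lemma selfdual_lower_growth:
  assumes C: "C > 0"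
  shows "\<exists>C0>0. \<forall>(l :: 'v::real_inner \<times> 'v \<Rightarrow> real) n. selfdual l \<longrightarrow> (\<forall>z. l z \<le> C * (pnorm p q z + n)) \<longrightarrow>
    (\<forall>z. C0 * pnorm p q z - C * n \<le> l z)"
proof -
  have dual: "\<exists>b. a \<bullet> b = t * norm a powr r \<and> norm b powr r' = t powr r' * norm a powr r"
    if "r > 1" "r' > 1" "1 / r + 1 / r' = 1" "t > 0" for a :: 'v and t r r' :: real
  proof (cases "a = 0")
    case False
    define b where "b = (t * norm a powr (r - 2)) *\<^sub>R a"
    have rr: "(r - 1) * r' = r" using that by (simp add: field_simps)
    have "a \<bullet> b = t * (norm a powr (r - 2) * norm a powr 2)"
      using False by (simp add: b_def powr_numeral power2_norm_eq_inner)
    also have "\<dots> = t * norm a powr r" unfolding powr_add[symmetric] by simp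
    finally have 1: "a \<bullet> b = t * norm a powr r" .
    have "norm b = t * (norm a powr (r - 2) * norm a powr 1)"
      using False that by (simp add: b_def)
    also have "\<dots> = t * norm a powr (r - 1)" unfolding powr_add[symmetric] by simp
    finally have "norm b powr r' = t powr r' * norm a powr r"
      using that rr by (simp add: powr_mult powr_powr)
    with 1 show ?thesis by blast
  qed (use that in auto)
  \<comment> \<open>small enough for \<open>C t\<^sup>p\<close> and \<open>C t\<^sup>q\<close> to be at most \<open>t / 2\<close>\<close>
  define t where "t = min ((1 / (2 * C)) powr (1 / (p - 1))) ((1 / (2 * C)) powr (1 / (q - 1)))"
  have t: "t > 0" using C by (simp add: t_def)
  have tr: "C * t powr r \<le> t / 2" if r: "r > 1" "t \<le> (1 / (2 * C)) powr (1 / (r - 1))" for r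
  proof -
    have "t powr (r - 1) \<le> ((1 / (2 * C)) powr (1 / (r - 1))) powr (r - 1)"
      using r t by (intro powr_mono2) auto
    also have "\<dots> = 1 / (2 * C)" using C r by (simp add: powr_powr)
    finally have "C * t powr (r - 1) \<le> 1 / 2" using C by (simp add: field_simps)
    then have "t * (C * t powr (r - 1)) \<le> t * (1 / 2)" using t by (intro mult_left_mono) auto
    moreover have "t powr r = t * t powr (r - 1)" using t by (simp add: powr_mult_base)
    ultimately show ?thesis by (simp add: ac_simps)
  qed
  have "t / 2 * pnorm p q z - C * n \<le> l z"
    if l: "selfdual l" and up: "\<And>z. l z \<le> C * (pnorm p q z + n)" for l n and z :: "'v \<times> 'v"
  proof -
    obtain b where b: "fst z \<bullet> b = t * norm (fst z) powr p" "norm b powr q = t powr q * norm (fst z) powr p"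
      using dual[OF p q_gt_1 pq t] by blast
    obtain a where a: "snd z \<bullet> a = t * norm (snd z) powr q" "norm a powr p = t powr p * norm (snd z) powr q"
      using dual[OF q_gt_1 p _ t] pq by (metis add.commute)
    have "t * pnorm p q z = dpair z (a, b)" using a b by (simp add: dpair_def pnorm_def algebra_simps)
    also have "\<dots> \<le> l z + l (a, b)" by (rule selfdual_Young[OF l])
    finally have 1: "t * pnorm p q z \<le> l z + l (a, b)" .
    have "l (a, b) \<le> C * (pnorm p q (a, b) + n)" by (rule up)
    also have "\<dots> = (C * t powr q) * norm (fst z) powr p + (C * t powr p) * norm (snd z) powr q + C * n"
      by (simp add: pnorm_def a b algebra_simps)
    also have "\<dots> \<le> t / 2 * norm (fst z) powr p + t / 2 * norm (snd z) powr q + C * n"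
      by (intro order_refl add_mono mult_right_mono tr p q_gt_1) (auto simp: t_def)
    finally have "l (a, b) \<le> t / 2 * pnorm p q z + C * n" by (simp add: pnorm_def distrib_left)
    with 1 show ?thesis by linarith
  qed
  moreover have "t / 2 > 0" using t by simp
  ultimately show ?thesis by blast
qed

lemma fitzpatrick_ge:
  assumes "c > 0" and A: "coercive_monotone p q c m A" and w: "w \<in> A"
  shows "dpair z w - coupling w \<le> fitzpatrick A z"
proof -
  have "bdd_above ((\<lambda>w. dpair z w - coupling w) ` A)"
  proof -
    obtain C where "\<forall>w\<in>A. dpair z w - coupling w \<le> C * pnorm p q z + m"
      using fitzpatrick_terms_le[OF assms(1)] A by blast
    then show ?thesis by (intro bdd_aboveI2) blast
  qed
  then show ?thesis unfolding fitzpatrick_def using w by (rule cSUP_upper[rotated])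
qed

text \<open>Estimate the Fitzpatrick function in each bridge from below by its term for the base point of the
  other bridge, and the two kernels by the pairing of \<open>z - w\<close> with \<open>z' - w'\<close>. In the sum everything except
  \<open>dpair z z'\<close> cancels.\<close>

lemma bridge_Young:
  assumes "c > 0" and A: "coercive_monotone p q c m A" and w: "w \<in> A" "w' \<in> A"
  shows "dpair z z' \<le> bridge p q A z w + bridge p q A z' w'"
proof -
  have "dpair (2 *\<^sub>R z - w) w' - coupling w' \<le> fitzpatrick A (2 *\<^sub>R z - w)"
    "dpair (2 *\<^sub>R z' - w') w - coupling w \<le> fitzpatrick A (2 *\<^sub>R z' - w')"
    using fitzpatrick_ge[OF assms(1) A] w by blast+
  moreover have "dpair (z - w) (z' - w') \<le> pq_kernel p q (z - w) + pq_kernel p q (z' - w')"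
    using pq_kernel_Young[of "z - w" "z' - w'"] by linarith
  ultimately show ?thesis
    unfolding bridge_def dpair_simps dpair_commute[of w z'] dpair_commute[of w w'] by (simp add: field_simps)
qed

lemma bdd_below_bridge:
  assumes "c > 0" and A: "coercive_monotone p q c m A"
  shows "bdd_below (bridge p q A z ` A)"
proof (cases "A = {}")
  case False
  then obtain v where "v \<in> A" by blast
  then have "dpair z 0 - bridge p q A 0 v \<le> bridge p q A z w" if "w \<in> A" for w
    using bridge_Young[OF assms that, of v z 0] by simp
  then show ?thesis by (rule bdd_belowI2)
qed simp

lemma prox_mean_le:
  assumes "c > 0" and A: "coercive_monotone p q c m A" and w: "w \<in> A"
  shows "prox_mean p q A z \<le> bridge p q A z w"
  unfolding prox_mean_def by (intro cINF_lower bdd_below_bridge[OF assms(1,2)] w)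

lemma subdual_prox_mean:
  assumes "c > 0" and A: "coercive_monotone p q c m A" "A \<noteq> {}"
  shows "subdual (prox_mean p q A)"
  unfolding subdual_def
proof (intro allI)
  fix z z'
  have "dpair z z' - bridge p q A z' w' \<le> prox_mean p q A z" if "w' \<in> A" for w'
    unfolding prox_mean_def using bridge_Young[OF assms(1,2) _ that, of _ z z']
    by (intro cINF_greatest A) (auto simp: algebra_simps)
  then have "dpair z z' - prox_mean p q A z \<le> prox_mean p q A z'"
    unfolding prox_mean_def[of _ _ _ z'] by (intro cINF_greatest A) (auto simp: algebra_simps)
  then show "dpair z z' \<le> prox_mean p q A z + prox_mean p q A z'" by simp
qed

text \<open>Choose the bridge from \<open>w\<close> to itself. The Fitzpatrick function is at most the coupling on \<open>A\<close> by
  monotonicity.\<close>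

lemma prox_mean_le_coupling:
  assumes "c > 0" and A: "coercive_monotone p q c m A" and w: "w \<in> A"
  shows "prox_mean p q A w \<le> coupling w"
proof -
  have "dpair w v - coupling v \<le> coupling w" if "v \<in> A" for v
    using A w that unfolding coercive_monotone_def by (fastforce simp: coupling_diff)
  then have "fitzpatrick A w \<le> coupling w"
    unfolding fitzpatrick_def using w by (intro cSUP_least) auto
  moreover have "bridge p q A w w = fitzpatrick A w / 2 + coupling w / 2"
    by (simp add: bridge_def pq_kernel_def scaleR_2)
  ultimately show ?thesis using prox_mean_le[OF assms, of w] by simp
qed

text \<open>The bridge from \<open>z\<close> to any fixed \<open>w\<close> in \<open>A\<close> has \<open>p, q\<close>-growth in \<open>z\<close>. The constant does not depend on
  \<open>A\<close>, which matters because \<open>A\<close> will vary with \<open>x\<close>.\<close>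

lemma prox_mean_growth:
  assumes c: "c > 0"
  shows "\<exists>C>0. \<forall>(A :: ('v::real_inner \<times> 'v) set) m. 0 \<le> m \<longrightarrow> coercive_monotone p q c m A \<longrightarrow>
    (\<forall>w\<in>A. \<forall>z. prox_mean p q A z \<le> C * (pnorm p q z + (pnorm p q w + m)))"
proof -
  obtain C where C: "C > 0" "\<And>(A :: ('v \<times> 'v) set) m z w. coercive_monotone p q c m A \<Longrightarrow> w \<in> A \<Longrightarrow>
      dpair z w - coupling w \<le> C * pnorm p q z + m"
    using fitzpatrick_terms_le[OF c] by blast
  define W where "W = 2 powr p + 2 powr q"
  have W: "W > 0" by (simp add: W_def add_pos_pos)
  have add: "pnorm p q (z - w) \<le> W * (pnorm p q z + pnorm p q w)" for z w :: "'v \<times> 'v"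
    using pnorm_add_le[of z "- w"] by (simp add: W_def pnorm_uminus)
  define B where "B = C * (W * (2 * W + 1)) + 1 + W"
  have "prox_mean p q A z \<le> B * (pnorm p q z + (pnorm p q w + m))"
    if m: "0 \<le> m" and A: "coercive_monotone p q c m A" and w: "w \<in> A" for A m and w z :: "'v \<times> 'v"
  proof -
    define S where "S = pnorm p q z + (pnorm p q w + m)"
    have n: "0 \<le> pnorm p q z" "0 \<le> pnorm p q w" by (rule pnorm_nonneg)+
    have S: "0 \<le> S" "pnorm p q z + pnorm p q w \<le> S" "pnorm p q w \<le> S" "m \<le> S" "pnorm p q z \<le> S"
      using n m by (auto simp: S_def)
    have "pnorm p q (z + z) \<le> W * (pnorm p q z + pnorm p q z)"
      using pnorm_add_le[of z z] by (simp add: W_def)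
    also have "\<dots> \<le> W * (S + S)" using W S by (intro mult_left_mono add_mono) auto
    finally have z2: "pnorm p q (2 *\<^sub>R z) \<le> 2 * W * S" by (simp add: scaleR_2)
    have "pnorm p q (2 *\<^sub>R z - w) \<le> W * (2 * W * S + S)"
      using add[of "2 *\<^sub>R z" w] z2 S W by (meson add_mono less_imp_le mult_left_mono order_trans)
    then have "C * pnorm p q (2 *\<^sub>R z - w) \<le> C * (W * (2 * W * S + S))"
      using C by simp
    then have "dpair (2 *\<^sub>R z - w) v - coupling v \<le> C * (W * (2 * W + 1)) * S + S" if "v \<in> A" for v
      using C(2)[OF A that, of "2 *\<^sub>R z - w"] S by (simp add: algebra_simps)
    then have 1: "fitzpatrick A (2 *\<^sub>R z - w) \<le> C * (W * (2 * W + 1)) * S + S"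
      unfolding fitzpatrick_def using w by (intro cSUP_least) auto
    have 2: "coupling w \<le> S"
      using coupling_le_pq_kernel[of w] pq_kernel_le_pnorm[of w] S by linarith
    have "W * (pnorm p q z + pnorm p q w) \<le> W * S" using S W by (intro mult_left_mono) auto
    then have 3: "pq_kernel p q (z - w) \<le> W * S"
      using pq_kernel_le_pnorm[of "z - w"] add[of z w] by linarith
    have 4: "0 \<le> C * (W * (2 * W + 1)) * S" using C W S by simp
    have "prox_mean p q A z \<le> bridge p q A z w" by (rule prox_mean_le[OF c A w])
    also have "\<dots> \<le> C * (W * (2 * W + 1)) * S + S + W * S"
      unfolding bridge_def using 1 2 3 4 by linarith
    finally show ?thesis by (simp add: B_def S_def algebra_simps)
  qed
  moreover have "B > 0" using C W by (simp add: B_def add_pos_pos)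
  ultimately show ?thesis by blast
qed

text \<open>The selfdual function below the proximal average is squeezed between the coupling and the proximal average,
  which is at most the coupling on \<open>A\<close>.\<close>

theorem selfdual_extension:
  fixes A :: "('v::euclidean_space \<times> 'v) set"
  assumes "c > 0" and A: "coercive_monotone p q c m A" "A \<noteq> {}"
  shows "selfdual (selfdual_below (prox_mean p q A))"
    and "A \<subseteq> touching_set (selfdual_below (prox_mean p q A))"
proof -
  note sd = subdual_prox_mean[OF assms]
  show l: "selfdual (selfdual_below (prox_mean p q A))" by (rule selfdual_selfdual_below[OF sd])
  show "A \<subseteq> touching_set (selfdual_below (prox_mean p q A))"
  proof
    fix w assume "w \<in> A"
    then have "selfdual_below (prox_mean p q A) w \<le> coupling w"
      using prox_mean_le_coupling[OF assms(1,2)] selfdual_below_le[OF sd, of w] by fastforce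
    then show "w \<in> touching_set (selfdual_below (prox_mean p q A))"
      using selfdual_ge_coupling[OF l, of w] by (simp add: touching_set_def)
  qed
qed

end

section \<open>Measurability\<close>

text \<open>Upper semicontinuity, which an infimum of continuous functions such as the proximal average has. It is
  enough regularity for the conjugate to be a supremum over a countable dense set.\<close>

definition usc :: "('w::topological_space \<Rightarrow> real) \<Rightarrow> bool" where
  "usc h \<longleftrightarrow> (\<forall>z. \<forall>e>0. \<forall>\<^sub>F y in nhds z. h y < h z + e)"

lemma uscD: "usc h \<Longrightarrow> e > 0 \<Longrightarrow> \<forall>\<^sub>F y in nhds z. h y < h z + e"
  unfolding usc_def by blast

lemma continuous_eventually_near:
  fixes g :: "'w::topological_space \<Rightarrow> real"
  assumes "continuous_on UNIV g" "e > 0"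
  shows "\<forall>\<^sub>F y in nhds z. \<bar>g y - g z\<bar> < e"
proof -
  have "(g \<longlongrightarrow> g z) (nhds z)"
    using assms(1) by (simp add: continuous_on_def tendsto_nhds_iff)
  from tendstoD[OF this assms(2)] show ?thesis by (simp add: dist_real_def)
qed

lemma usc_half_sum:
  assumes "usc h" "continuous_on UNIV g"
  shows "usc (\<lambda>z. (h z + g z) / 2)"
  unfolding usc_def
proof (intro allI impI)
  fix z and e :: real assume e: "e > 0"
  show "\<forall>\<^sub>F y in nhds z. (h y + g y) / 2 < (h z + g z) / 2 + e"
    using uscD[OF assms(1) e, of z] continuous_eventually_near[OF assms(2) e, of z]
    by eventually_elim (auto simp: field_simps)
qed

lemma usc_INF:
  assumes "I \<noteq> {}" and cont: "\<And>i. i \<in> I \<Longrightarrow> continuous_on UNIV (g i)"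
    and bdd: "\<And>z. bdd_below ((\<lambda>i. g i z) ` I)"
  shows "usc (\<lambda>z. INF i\<in>I. g i z)"
  unfolding usc_def
proof (intro allI impI)
  fix z and e :: real assume e: "e > 0"
  then have "(INF i\<in>I. g i z) < (INF i\<in>I. g i z) + e / 2" by simp
  then obtain i where i: "i \<in> I" "g i z < (INF i\<in>I. g i z) + e / 2"
    using cINF_less_iff[OF assms(1) bdd] by blast
  have "\<forall>\<^sub>F y in nhds z. \<bar>g i y - g i z\<bar> < e / 2"
    by (rule continuous_eventually_near[OF cont[OF i(1)] half_gt_zero[OF e]])
  then show "\<forall>\<^sub>F y in nhds z. (INF i\<in>I. g i y) < (INF i\<in>I. g i z) + e"
  proof eventually_elim
    case (elim y)
    have "(INF i\<in>I. g i y) \<le> g i y" by (rule cINF_lower[OF bdd i(1)])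
    with elim i(2) show ?case by linarith
  qed
qed

lemma usc_dual_mean:
  fixes h :: "'v::euclidean_space \<times> 'v \<Rightarrow> real"
  assumes "subdual h" "usc h"
  shows "usc (dual_mean h n)"
proof (induction n)
  case (Suc n)
  then show ?case
    using usc_half_sum[OF Suc dconj_continuous[OF subdual_dual_mean[OF assms(1)]]] by simp
qed (use assms in simp)

text \<open>The functions \<open>dpair _ w - h\<close> are lower semicontinuous, so each of their values is
  almost attained on an open set and hence on \<open>D\<close>.\<close>

lemma dconj_dense:
  fixes h :: "'v::euclidean_space \<times> 'v \<Rightarrow> real"
  assumes h: "subdual h" "usc h" and D: "\<And>U. open U \<Longrightarrow> U \<noteq> {} \<Longrightarrow> \<exists>d\<in>D. d \<in> U"
  shows "dconj h w = (SUP z\<in>D. dpair z w - h z)"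
proof (rule antisym)
  have bdd: "bdd_above ((\<lambda>z. dpair z w - h z) ` D)"
    by (rule bdd_above_mono[OF dconj_bdd[OF h(1)]]) auto
  show "dconj h w \<le> (SUP z\<in>D. dpair z w - h z)"
  proof (rule dconj_least)
    fix z
    show "dpair z w \<le> h z + (SUP z\<in>D. dpair z w - h z)"
    proof (rule field_le_epsilon)
      fix e :: real assume e: "e > 0"
      have "continuous_on UNIV (\<lambda>y. dpair y w)" by (intro continuous_intros)
      then have "\<forall>\<^sub>F y in nhds z. \<bar>dpair y w - dpair z w\<bar> < e / 2"
        by (rule continuous_eventually_near[OF _ half_gt_zero[OF e]])
      moreover have "\<forall>\<^sub>F y in nhds z. h y < h z + e / 2" by (rule uscD[OF h(2) half_gt_zero[OF e]])
      ultimately have "\<forall>\<^sub>F y in nhds z. dpair z w - h z - e < dpair y w - h y"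
        by eventually_elim linarith
      then obtain U where U: "open U" "z \<in> U" "\<And>y. y \<in> U \<Longrightarrow> dpair z w - h z - e < dpair y w - h y"
        unfolding eventually_nhds by blast
      obtain d where d: "d \<in> D" "d \<in> U" using D[OF U(1)] U(2) by blast
      have "dpair d w - h d \<le> (SUP z\<in>D. dpair z w - h z)" by (rule cSUP_upper[OF d(1) bdd])
      then show "dpair z w \<le> h z + (SUP z\<in>D. dpair z w - h z) + e"
        using U(3)[OF d(2)] by linarith
    qed
  qed
  have "D \<noteq> {}" using D[of UNIV] by auto
  then show "(SUP z\<in>D. dpair z w - h z) \<le> dconj h w"
  proof (rule cSUP_least)
    show "dpair z w - h z \<le> dconj h w" for z using dconj_upper[OF h(1), of z w] by linarith
  qed
qed

lemma borel_measurable_components: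
  fixes f :: "'x \<Rightarrow> 'v::euclidean_space \<times> 'v"
  assumes f: "f \<in> borel_measurable M"
  shows "(\<lambda>x. fst (f x)) \<in> borel_measurable M" "(\<lambda>x. snd (f x)) \<in> borel_measurable M"
  by (rule measurable_compose[OF f], intro borel_measurable_continuous_onI continuous_intros)+

lemma borel_measurable_coupling [measurable (raw)]:
  fixes f :: "'x \<Rightarrow> 'v::euclidean_space \<times> 'v"
  shows "f \<in> borel_measurable M \<Longrightarrow> (\<lambda>x. coupling (f x)) \<in> borel_measurable M"
  unfolding coupling_def by (intro borel_measurable_inner borel_measurable_components)

lemma borel_measurable_dpair [measurable (raw)]:
  fixes f g :: "'x \<Rightarrow> 'v::euclidean_space \<times> 'v"
  shows "f \<in> borel_measurable M \<Longrightarrow> g \<in> borel_measurable M \<Longrightarrow> (\<lambda>x. dpair (f x) (g x)) \<in> borel_measurable M"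
  unfolding dpair_def by (intro borel_measurable_add borel_measurable_inner borel_measurable_components)

lemma borel_measurable_pq_kernel [measurable (raw)]:
  fixes f :: "'x \<Rightarrow> 'v::euclidean_space \<times> 'v"
  assumes "f \<in> borel_measurable M"
  shows "(\<lambda>x. pq_kernel p q (f x)) \<in> borel_measurable M"
proof -
  note [measurable] = borel_measurable_components[OF assms]
  show ?thesis unfolding pq_kernel_def by measurable
qed

lemma measurable_dual_mean:
  fixes h :: "'x \<Rightarrow> 'v::euclidean_space \<times> 'v \<Rightarrow> real"
  assumes h: "\<And>x. x \<in> space M \<Longrightarrow> subdual (h x)" "\<And>x. x \<in> space M \<Longrightarrow> usc (h x)"
    and meas: "(\<lambda>y. h (fst y) (snd y)) \<in> borel_measurable (M \<Otimes>\<^sub>M borel)"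
  shows "(\<lambda>y. dual_mean (h (fst y)) n (snd y)) \<in> borel_measurable (M \<Otimes>\<^sub>M borel)"
proof (induction n)
  case 0
  then show ?case using meas by simp
next
  case (Suc n)
  note [measurable] = Suc
  obtain D :: "('v \<times> 'v) set" where D: "countable D" "\<And>U. open U \<Longrightarrow> U \<noteq> {} \<Longrightarrow> \<exists>d\<in>D. d \<in> U"
    by (rule countable_dense_setE) blast
  have "(\<lambda>y. SUP z\<in>D. dpair z (snd y) - dual_mean (h (fst y)) n z) \<in> borel_measurable (M \<Otimes>\<^sub>M borel)"
  proof (rule borel_measurable_cSUP[OF D(1)])
    fix z
    have "(\<lambda>y. (\<lambda>y. dual_mean (h (fst y)) n (snd y)) (fst y, z)) \<in> borel_measurable (M \<Otimes>\<^sub>M borel)"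
      by (rule measurable_compose[OF _ Suc]) measurable
    then have [measurable]: "(\<lambda>y. dual_mean (h (fst y)) n z) \<in> borel_measurable (M \<Otimes>\<^sub>M borel)"
      by simp
    show "(\<lambda>y. dpair z (snd y) - dual_mean (h (fst y)) n z) \<in> borel_measurable (M \<Otimes>\<^sub>M borel)"
      by measurable
  next
    fix y assume "y \<in> space (M \<Otimes>\<^sub>M (borel :: ('v \<times> 'v) measure))"
    then have "fst y \<in> space M" by (auto simp: space_pair_measure)
    then show "bdd_above ((\<lambda>z. dpair z (snd y) - dual_mean (h (fst y)) n z) ` D)"
      by (intro bdd_above_mono[OF dconj_bdd[OF subdual_dual_mean[OF h(1)]]]) auto
  qed
  then have "(\<lambda>y. dconj (dual_mean (h (fst y)) n) (snd y)) \<in> borel_measurable (M \<Otimes>\<^sub>M borel)"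
  proof (rule measurable_cong[THEN iffD1, rotated])
    fix y assume "y \<in> space (M \<Otimes>\<^sub>M (borel :: ('v \<times> 'v) measure))"
    then have "fst y \<in> space M" by (auto simp: space_pair_measure)
    then show "(SUP z\<in>D. dpair z (snd y) - dual_mean (h (fst y)) n z) = dconj (dual_mean (h (fst y)) n) (snd y)"
      using dconj_dense[OF subdual_dual_mean usc_dual_mean D(2)] h by metis
  qed
  then show ?case by simp
qed

lemma measurable_selfdual_below:
  fixes h :: "'x \<Rightarrow> 'v::euclidean_space \<times> 'v \<Rightarrow> real"
  assumes h: "\<And>x. x \<in> space M \<Longrightarrow> subdual (h x)" "\<And>x. x \<in> space M \<Longrightarrow> usc (h x)"
    and meas: "(\<lambda>y. h (fst y) (snd y)) \<in> borel_measurable (M \<Otimes>\<^sub>M borel)"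
  shows "(\<lambda>y. selfdual_below (h (fst y)) (snd y)) \<in> borel_measurable (M \<Otimes>\<^sub>M borel)"
proof (rule borel_measurable_LIMSEQ_real)
  show "(\<lambda>y. dual_mean (h (fst y)) n (snd y)) \<in> borel_measurable (M \<Otimes>\<^sub>M borel)" for n
    by (rule measurable_dual_mean[OF h meas])
  fix y assume "y \<in> space (M \<Otimes>\<^sub>M (borel :: ('v \<times> 'v) measure))"
  then have "fst y \<in> space M" by (auto simp: space_pair_measure)
  then show "(\<lambda>n. dual_mean (h (fst y)) n (snd y)) \<longlonglongrightarrow> selfdual_below (h (fst y)) (snd y)"
    by (intro dual_mean_tendsto h)
qed

lemma continuous_pq_kernel:
  assumes "p > 0" "q > 0"
  shows "continuous_on UNIV (pq_kernel p q)"
  unfolding pq_kernel_def using assms by (intro continuous_intros continuous_on_powr') auto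

lemma continuous_fitzpatrick:
  fixes A :: "('v::euclidean_space \<times> 'v) set"
  assumes pq: "p > 1" "1 / p + 1 / q = 1" and "c > 0" and A: "coercive_monotone p q c m A" "A \<noteq> {}"
  shows "continuous_on UNIV (fitzpatrick A)"
proof (rule convex_on_continuous[OF open_UNIV], rule convex_onI)
  note ge = fitzpatrick_ge[OF pq assms(3) A(1)]
  fix t :: real and x y :: "'v \<times> 'v" assume t: "0 < t" "t < 1"
  show "fitzpatrick A ((1 - t) *\<^sub>R x + t *\<^sub>R y) \<le> (1 - t) * fitzpatrick A x + t * fitzpatrick A y"
    unfolding fitzpatrick_def[of A "(1 - t) *\<^sub>R x + t *\<^sub>R y"]
  proof (rule cSUP_least[OF A(2)])
    fix w assume w: "w \<in> A"
    have "(1 - t) * (dpair x w - coupling w) \<le> (1 - t) * fitzpatrick A x"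
      "t * (dpair y w - coupling w) \<le> t * fitzpatrick A y"
      using t ge[OF w] by (intro mult_left_mono; simp)+
    then show "dpair ((1 - t) *\<^sub>R x + t *\<^sub>R y) w - coupling w
        \<le> (1 - t) * fitzpatrick A x + t * fitzpatrick A y"
      by (simp add: dpair_simps algebra_simps)
  qed
qed auto

lemma usc_prox_mean:
  fixes A :: "('v::euclidean_space \<times> 'v) set"
  assumes pq: "p > 1" "1 / p + 1 / q = 1" and "c > 0" and A: "coercive_monotone p q c m A" "A \<noteq> {}"
  shows "usc (prox_mean p q A)"
  unfolding prox_mean_def
proof (rule usc_INF[OF A(2)])
  fix w
  have 1: "continuous_on UNIV (\<lambda>z. fitzpatrick A (2 *\<^sub>R z - w))"
    by (rule continuous_on_compose2[OF continuous_fitzpatrick[OF assms]]) (auto intro!: continuous_intros)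
  have 2: "continuous_on UNIV (\<lambda>z. pq_kernel p q (z - w))"
    using pq conjugate_exponent_gt_1[OF pq]
    by (intro continuous_on_compose2[OF continuous_pq_kernel]) (auto intro!: continuous_intros)
  show "continuous_on UNIV (\<lambda>z. bridge p q A z w)"
    unfolding bridge_def by (intro continuous_intros 1 2) auto
qed (rule bdd_below_bridge[OF pq assms(3) A(1)])

lemma measurable_prox_mean:
  fixes \<zeta> :: "'d \<Rightarrow> 'x \<Rightarrow> 'v::euclidean_space \<times> 'v"
  assumes pq: "p > 1" "1 / p + 1 / q = 1" and c: "c > 0"
    and I: "countable I" "I \<noteq> {}" and \<zeta> [measurable]: "\<And>i. i \<in> I \<Longrightarrow> \<zeta> i \<in> borel_measurable M"
    and A: "\<And>x. x \<in> space M \<Longrightarrow> coercive_monotone p q c (m x) ((\<lambda>i. \<zeta> i x) ` I)"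
  shows "(\<lambda>y. prox_mean p q ((\<lambda>i. \<zeta> i (fst y)) ` I) (snd y)) \<in> borel_measurable (M \<Otimes>\<^sub>M borel)"
proof -
  have F [measurable]: "(\<lambda>y. fitzpatrick ((\<lambda>i. \<zeta> i (fst y)) ` I) (snd y)) \<in> borel_measurable (M \<Otimes>\<^sub>M borel)"
    unfolding fitzpatrick_def image_image
  proof (rule borel_measurable_cSUP[OF I(1)])
    show "(\<lambda>y. dpair (snd y) (\<zeta> i (fst y)) - coupling (\<zeta> i (fst y))) \<in> borel_measurable (M \<Otimes>\<^sub>M borel)"
      if [measurable]: "i \<in> I" for i by measurable
    fix y assume "y \<in> space (M \<Otimes>\<^sub>M (borel :: ('v \<times> 'v) measure))"
    then have "fst y \<in> space M" by (auto simp: space_pair_measure)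
    from fitzpatrick_terms_le[OF pq c] A[OF this] obtain C where
      "\<And>w. w \<in> (\<lambda>i. \<zeta> i (fst y)) ` I \<Longrightarrow> dpair (snd y) w - coupling w \<le> C * pnorm p q (snd y) + m (fst y)"
      by blast
    then show "bdd_above ((\<lambda>i. dpair (snd y) (\<zeta> i (fst y)) - coupling (\<zeta> i (fst y))) ` I)"
      by (intro bdd_aboveI2[where M = "C * pnorm p q (snd y) + m (fst y)"]) blast
  qed
  show ?thesis
    unfolding prox_mean_def image_image
  proof (rule borel_measurable_cINF_real[OF I(1)])
    fix i assume [measurable]: "i \<in> I"
    have "(\<lambda>y. (\<lambda>y. fitzpatrick ((\<lambda>i. \<zeta> i (fst y)) ` I) (snd y)) (fst y, 2 *\<^sub>R snd y - \<zeta> i (fst y)))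
        \<in> borel_measurable (M \<Otimes>\<^sub>M borel)"
      by (rule measurable_compose[OF _ F]) measurable
    then have [measurable]: "(\<lambda>y. fitzpatrick ((\<lambda>i. \<zeta> i (fst y)) ` I) (2 *\<^sub>R snd y - \<zeta> i (fst y)))
        \<in> borel_measurable (M \<Otimes>\<^sub>M borel)" by simp
    show "(\<lambda>y. bridge p q ((\<lambda>i. \<zeta> i (fst y)) ` I) (snd y) (\<zeta> i (fst y))) \<in> borel_measurable (M \<Otimes>\<^sub>M borel)"
      unfolding bridge_def by measurable
  qed
qed

text \<open>The point of \<open>K\<close> closest to \<open>a\<close> lies in a closed set \<open>C\<close> if and only if every closed ball around \<open>a\<close> of
  rational radius that meets \<open>K\<close> also meets \<open>K \<inter> C\<close>. This expresses the event through countably many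
  hitting events of closed sets.\<close>

lemma measurable_closest_point:
  fixes K :: "'x \<Rightarrow> 'v::euclidean_space set"
  assumes K: "\<And>C. closed C \<Longrightarrow> {x \<in> space M. K x \<inter> C \<noteq> {}} \<in> sets M"
    and G [measurable]: "G \<in> sets M"
    and good: "\<And>x. x \<in> G \<Longrightarrow> closed (K x) \<and> convex (K x) \<and> K x \<noteq> {}"
  shows "(\<lambda>x. if x \<in> G then closest_point (K x) a else a) \<in> borel_measurable M"
proof (rule borel_measurableI)
  let ?s = "\<lambda>x. if x \<in> G then closest_point (K x) a else a"
  have key: "closest_point (K x) a \<in> C \<longleftrightarrow>
      (\<forall>r\<in>\<rat>. K x \<inter> cball a r \<noteq> {} \<longrightarrow> K x \<inter> (C \<inter> cball a r) \<noteq> {})" (is "_ \<longleftrightarrow> ?R")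
    if x: "x \<in> G" and C: "closed C" for x C
  proof
    note g = good[OF x]
    let ?k = "closest_point (K x) a"
    have k: "?k \<in> K x" using g by (intro closest_point_in_set) auto
    show ?R if "?k \<in> C"
    proof (intro ballI impI)
      fix r :: real assume "K x \<inter> cball a r \<noteq> {}"
      then obtain y where "y \<in> K x" "dist a y \<le> r" by auto
      then have "?k \<in> cball a r" using closest_point_le[of "K x" y a] g by auto
      then show "K x \<inter> (C \<inter> cball a r) \<noteq> {}" using k that by blast
    qed
    show "?k \<in> C" if R: ?R
    proof -
      have near: "K x \<inter> (C \<inter> cball a r) \<noteq> {}" if "r \<in> \<rat>" "dist a ?k < r" for r
      proof -
        have "?k \<in> K x \<inter> cball a r" using k that by auto
        then show ?thesis using R that by blast
      qed
      obtain r0 where r0: "r0 \<in> \<rat>" "dist a ?k < r0"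
        using Rats_dense_in_real[of "dist a ?k" "dist a ?k + 1"] by auto
      have cl: "closed (K x \<inter> C)" using g C by auto
      have ne: "K x \<inter> C \<noteq> {}" using near[OF r0] by blast
      let ?j = "closest_point (K x \<inter> C) a"
      have j: "?j \<in> K x \<inter> C" by (rule closest_point_in_set[OF cl ne])
      have "dist a ?j \<le> dist a ?k"
      proof (rule ccontr)
        assume "\<not> ?thesis"
        then obtain r where r: "r \<in> \<rat>" "dist a ?k < r" "r < dist a ?j"
          using Rats_dense_in_real[of "dist a ?k" "dist a ?j"] by auto
        obtain y where "y \<in> K x \<inter> C" "y \<in> cball a r" using near[OF r(1,2)] by blast
        then show False using closest_point_le[OF cl, of y a] r(3) by auto
      qed
      then have "\<forall>y\<in>K x. dist a ?j \<le> dist a y"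
        using closest_point_le[of "K x" _ a] g by force
      then have "?j = ?k" using j g by (intro closest_point_unique) auto
      then show ?thesis using j by auto
    qed
  qed
  fix S :: "'v set" assume "open S"
  then have cl: "closed (- S)" by auto
  have "{x \<in> space M. K x \<inter> cball a r \<noteq> {} \<longrightarrow> K x \<inter> (- S \<inter> cball a r) \<noteq> {}} \<in> sets M" for r
    using K[of "cball a r"] K[of "- S \<inter> cball a r"] cl
    by (intro sets.sets_Collect_imp) auto
  then have "{x \<in> space M. \<forall>r\<in>\<rat>. K x \<inter> cball a r \<noteq> {} \<longrightarrow> K x \<inter> (- S \<inter> cball a r) \<noteq> {}} \<in> sets M"
    by (intro sets.sets_Collect_countable_All' countable_rat)
  moreover define T where
    "T = {x \<in> space M. \<forall>r\<in>\<rat>. K x \<inter> cball a r \<noteq> {} \<longrightarrow> K x \<inter> (- S \<inter> cball a r) \<noteq> {}}"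
  ultimately have [measurable]: "T \<in> sets M" by simp
  have T: "x \<in> T \<longleftrightarrow> closest_point (K x) a \<notin> S" if "x \<in> G" for x
    using key[OF that cl] sets.sets_into_space[OF G] that unfolding T_def by blast
  have "(G - T) \<union> (if a \<in> S then space M - G else {}) \<in> sets M" by auto
  also have "(G - T) \<union> (if a \<in> S then space M - G else {}) = ?s -` S \<inter> space M"
    using T sets.sets_into_space[OF G] by (auto split: if_splits)
  finally show "?s -` S \<inter> space M \<in> sets M" .
qed

section \<open>Vector fields of selfdual Lagrangians\<close>

lemma monotone_map_iff:
  "monotone_map B \<longleftrightarrow> (\<forall>z w. snd z \<in> B (fst z) \<longrightarrow> snd w \<in> B (fst w) \<longrightarrow> 0 \<le> coupling (z - w))"
  unfolding monotone_map_def coupling_def by (auto simp: split_paired_all)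

text \<open>Otherwise the map could be enlarged by the pair \<open>z\<close>.\<close>

lemma maximal_monotone_mapD:
  assumes B: "maximal_monotone_map B" and z: "\<And>w. snd w \<in> B (fst w) \<Longrightarrow> 0 \<le> coupling (z - w)"
  shows "snd z \<in> B (fst z)"
proof -
  define B' where "B' = (\<lambda>\<xi>. if \<xi> = fst z then insert (snd z) (B \<xi>) else B \<xi>)"
  have B': "snd w \<in> B' (fst w) \<longleftrightarrow> snd w \<in> B (fst w) \<or> w = z" for w
    by (auto simp: B'_def prod_eq_iff)
  have mon: "monotone_map B" using B by (simp add: maximal_monotone_map_def)
  have flip: "coupling (w - z) = coupling (z - w)" for w
    by (simp add: coupling_diff dpair_commute)
  have "monotone_map B'"
    unfolding monotone_map_iff B'
  proof (intro allI impI)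
    fix w v assume "snd w \<in> B (fst w) \<or> w = z" "snd v \<in> B (fst v) \<or> v = z"
    then show "0 \<le> coupling (w - v)"
      using mon[unfolded monotone_map_iff] z[of w] z[of v] flip[of w]
      by (elim disjE) (auto simp: coupling_def)
  qed
  moreover have "B \<xi> \<subseteq> B' \<xi>" for \<xi> by (auto simp: B'_def)
  ultimately have "B' = B" using B by (simp add: maximal_monotone_map_def)
  then show ?thesis using B'[of z] by simp
qed

lemma maximal_monotone_map_touching:
  fixes l :: "'v::euclidean_space \<times> 'v \<Rightarrow> real"
  assumes l: "selfdual l"
  shows "maximal_monotone_map (\<lambda>a. {b. (a, b) \<in> touching_set l})"
  unfolding maximal_monotone_map_def
proof (intro conjI allI impI)
  show "monotone_map (\<lambda>a. {b. (a, b) \<in> touching_set l})"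
    unfolding monotone_map_iff using touching_monotone[OF l] by simp
  fix B assume "monotone_map B \<and> (\<forall>\<xi>. {b. (\<xi>, b) \<in> touching_set l} \<subseteq> B \<xi>)"
  then have mon: "monotone_map B" and sub: "\<And>\<xi> b. (\<xi>, b) \<in> touching_set l \<Longrightarrow> b \<in> B \<xi>" by blast+
  have "(a, b) \<in> touching_set l" if "b \<in> B a" for a b
  proof (rule touching_maximal[OF l])
    fix w assume "w \<in> touching_set l"
    then have "snd w \<in> B (fst w)" by (intro sub) simp
    then show "0 \<le> coupling ((a, b) - w)"
      using mon[unfolded monotone_map_iff] that by (metis fst_conv snd_conv)
  qed
  with sub show "B = (\<lambda>a. {b. (a, b) \<in> touching_set l})" by blast
qed

text \<open>The selfdual extension of the graph touches the coupling on a monotone set that contains the graph, and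
  by maximality the two sets are equal. Through this representation \<open>B\<close> inherits
  full domain, closed convex values and local boundedness from the properties of selfdual functions.\<close>

lemma maximal_coercive_eq_touching:
  fixes B :: "'v::euclidean_space \<Rightarrow> 'v set"
  assumes pq: "p > 1" "1 / p + 1 / q = 1" and c: "c > 0" and B: "maximal_monotone_map B"
    and coer: "\<And>\<xi> \<eta>. \<eta> \<in> B \<xi> \<Longrightarrow> c * pnorm p q (\<xi>, \<eta>) - m \<le> \<xi> \<bullet> \<eta>"
  shows "\<exists>l. selfdual l \<and> touching_set l = {z. snd z \<in> B (fst z)}"
proof -
  define A where "A = {z. snd z \<in> B (fst z)}"
  have mon: "monotone_map B" using B by (simp add: maximal_monotone_map_def)
  have A: "coercive_monotone p q c m A"
    unfolding coercive_monotone_def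
  proof (intro conjI ballI)
    show "0 \<le> coupling (z - w)" if "z \<in> A" "w \<in> A" for z w
      using mon that unfolding monotone_map_iff A_def by blast
    show "c * pnorm p q z - m \<le> coupling z" if "z \<in> A" for z
      using coer[of "snd z" "fst z"] that by (simp add: A_def coupling_def)
  qed
  have "A \<noteq> {}"
  proof
    assume "A = {}"
    then have no: "\<And>w. snd w \<notin> B (fst w)" unfolding A_def by blast
    have "snd (0 :: 'v \<times> 'v) \<in> B (fst (0 :: 'v \<times> 'v))"
      by (rule maximal_monotone_mapD[OF B, of 0]) (use no in blast)
    with no show False by blast
  qed
  from selfdual_extension[OF pq c A this] obtain l where l: "selfdual l" "A \<subseteq> touching_set l" by blast
  have "z \<in> A" if "z \<in> touching_set l" for z
    unfolding A_def mem_Collect_eq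
  proof (rule maximal_monotone_mapD[OF B])
    fix w assume "snd w \<in> B (fst w)"
    then have "w \<in> touching_set l" using l(2) by (auto simp: A_def)
    then show "0 \<le> coupling (z - w)" by (rule touching_monotone[OF l(1) that])
  qed
  with l show ?thesis unfolding A_def by blast
qed

lemma convex_touching_fibre:
  assumes l: "selfdual l"
  shows "convex {b. (a, b) \<in> touching_set l}"
proof (rule convexI)
  fix x y and u v :: real
  assume xy: "x \<in> {b. (a, b) \<in> touching_set l}" "y \<in> {b. (a, b) \<in> touching_set l}"
    and uv: "0 \<le> u" "0 \<le> v" "u + v = 1"
  have "l (u *\<^sub>R (a, x) + v *\<^sub>R (a, y)) \<le> u * l (a, x) + v * l (a, y)"
    using selfdual_convex[OF l] uv by (simp add: convex_on_def)
  also have "u *\<^sub>R (a, x) + v *\<^sub>R (a, y) = (a, u *\<^sub>R x + v *\<^sub>R y)"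
    using uv by (simp flip: scaleR_add_left)
  also have "u * l (a, x) + v * l (a, y) = coupling (a, u *\<^sub>R x + v *\<^sub>R y)"
    using xy by (simp add: touching_set_def coupling_def inner_simps)
  finally show "u *\<^sub>R x + v *\<^sub>R y \<in> {b. (a, b) \<in> touching_set l}"
    using selfdual_ge_coupling[OF l, of "(a, u *\<^sub>R x + v *\<^sub>R y)"] by (simp add: touching_set_def)
qed

lemma closed_touching_fibre:
  fixes l :: "'v::euclidean_space \<times> 'v \<Rightarrow> real"
  assumes l: "selfdual l"
  shows "closed {b. (a, b) \<in> touching_set l}"
  using closed_vimage[OF closed_touching[OF l], of "Pair a"]
  by (simp add: vimage_def continuous_intros)

lemma vector_field_eq:
  "vector_field (\<lambda>x a b. ereal (L x a b)) x a = {b. (a, b) \<in> touching_set (\<lambda>z. L x (fst z) (snd z))}"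
  by (simp add: vector_field_def touching_set_def coupling_def)

lemma Lagrangian_conj_real:
  "(\<forall>a b. Lagrangian_conj (\<lambda>x a b. ereal (L x a b)) x b a = ereal (L x a b))
     \<longleftrightarrow> selfdual (\<lambda>z. L x (fst z) (snd z))" (is "?lhs \<longleftrightarrow> ?rhs")
proof -
  define l where "l = (\<lambda>z. L x (fst z) (snd z))"
  have conj: "Lagrangian_conj (\<lambda>x a b. ereal (L x a b)) x b a = (SUP z. ereal (dpair z (a, b) - l z))" for a b
    unfolding Lagrangian_conj_def
    by (intro SUP_cong) (auto simp: l_def dpair_def inner_commute)
  show ?thesis
  proof
    assume ?lhs
    then have eq: "(SUP z. ereal (dpair z w - l z)) = ereal (l w)" for w
      using conj[of "snd w" "fst w"] by (simp add: l_def)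
    show ?rhs
      unfolding selfdual_def l_def[symmetric]
    proof (intro conjI allI impI)
      fix z w
      have "ereal (dpair z w - l z) \<le> ereal (l w)"
        unfolding eq[symmetric] by (rule SUP_upper) simp
      then show "dpair z w \<le> l z + l w" by simp
    next
      fix w M assume M: "\<forall>z. dpair z w \<le> l z + M"
      have "(SUP z. ereal (dpair z w - l z)) \<le> ereal M"
      proof (rule SUP_least)
        show "ereal (dpair z w - l z) \<le> ereal M" for z using M[rule_format, of z] by simp
      qed
      then show "l w \<le> M" by (simp add: eq)
    qed
  next
    assume ?rhs
    then have sd: "selfdual l" by (simp add: l_def)
    have "(SUP z. ereal (dpair z w - l z)) = ereal (l w)" for w
    proof (rule antisym)
      show "(SUP z. ereal (dpair z w - l z)) \<le> ereal (l w)"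
      proof (rule SUP_least)
        show "ereal (dpair z w - l z) \<le> ereal (l w)" for z
          using selfdual_Young[OF sd, of z w] by simp
      qed
      have up: "ereal (dpair z w - l z) \<le> (SUP z. ereal (dpair z w - l z))" for z
        by (rule SUP_upper) simp
      show "ereal (l w) \<le> (SUP z. ereal (dpair z w - l z))"
      proof (cases "SUP z. ereal (dpair z w - l z)")
        case (real r)
        have "l w \<le> r"
        proof (rule selfdual_least[OF sd])
          show "dpair z w \<le> l z + r" for z using up[of z] by (simp add: real)
        qed
        then show ?thesis by (simp add: real)
      next
        case MInf
        then show ?thesis using up[of 0] by simp
      qed simp
    qed
    then show ?lhs unfolding conj by (simp add: l_def)
  qed
qed

text \<open>For a real Lagrangian, convexity and lower semicontinuity are consequences of selfduality, so that only
  measurability and selfduality in the sense of \<open>selfdual\<close> remain.\<close>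

lemma selfdual_Lagrangian_real:
  fixes L :: "'v::euclidean_space \<Rightarrow> 'v \<Rightarrow> 'v \<Rightarrow> real"
  shows "selfdual_Lagrangian \<Omega> (\<lambda>x a b. ereal (L x a b)) \<longleftrightarrow>
    (\<lambda>y. L (fst y) (fst (snd y)) (snd (snd y))) \<in> borel_measurable (lebesgue_on \<Omega> \<Otimes>\<^sub>M borel) \<and>
    (\<forall>x\<in>\<Omega>. selfdual (\<lambda>z. L x (fst z) (snd z)))"
proof -
  have "ereal_convex (\<lambda>(a, b). ereal (L x a b)) \<and> ereal_lsc (\<lambda>(a, b). ereal (L x a b))"
    if sd: "selfdual (\<lambda>z. L x (fst z) (snd z))" for x
  proof
    let ?l = "\<lambda>z. L x (fst z) (snd z)"
    have eq: "(\<lambda>(a, b). ereal (L x a b)) = (\<lambda>z. ereal (?l z))" by auto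
    show "ereal_convex (\<lambda>(a, b). ereal (L x a b))"
      unfolding ereal_convex_def eq
    proof (intro allI impI)
      fix z w :: "'v \<times> 'v" and t :: real assume "0 < t \<and> t < 1"
      then have "?l ((1 - t) *\<^sub>R z + t *\<^sub>R w) \<le> (1 - t) * ?l z + t * ?l w"
        by (intro convex_onD[OF selfdual_convex[OF sd]]) auto
      then show "ereal (?l ((1 - t) *\<^sub>R z + t *\<^sub>R w)) \<le> ereal (1 - t) * ereal (?l z) + ereal t * ereal (?l w)"
        by simp
    qed
    show "ereal_lsc (\<lambda>(a, b). ereal (L x a b))"
      unfolding ereal_lsc_def eq
    proof
      fix z :: "'v \<times> 'v"
      have "(?l \<longlongrightarrow> ?l z) (at z)"
        using selfdual_continuous[OF sd] isContD continuous_on_eq_continuous_at[OF open_UNIV] UNIV_I by blast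
      then have "((\<lambda>z. ereal (?l z)) \<longlongrightarrow> ereal (?l z)) (at z)" by (rule tendsto_ereal)
      then have "Liminf (at z) (\<lambda>z. ereal (?l z)) = ereal (?l z)"
        by (intro lim_imp_Liminf) auto
      then show "ereal (?l z) \<le> Liminf (at z) (\<lambda>z. ereal (?l z))" by simp
    qed
  qed
  moreover have "(\<lambda>(x, (a, b)). ereal (L x a b)) = (\<lambda>y. ereal (L (fst y) (fst (snd y)) (snd (snd y))))"
    by auto
  ultimately show ?thesis
    unfolding selfdual_Lagrangian_def by (auto simp: Lagrangian_conj_real)
qed

text \<open>Coercivity is the lower growth bound read on the graph, where the Lagrangian equals \<open>\<xi> \<bullet> \<eta>\<close>. Maximal
  monotonicity and closed values come from selfduality at each \<open>x\<close>. For measurability, \<open>C\<close> is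
  exhausted by compact sets; on a compact set the nonnegative continuous function \<open>L x \<xi> \<eta> - \<xi> \<bullet> \<eta>\<close> of \<open>\<eta>\<close>
  has a zero if and only if it takes arbitrarily small values on a countable dense subset.\<close>

theorem vector_field_in_M_class:
  fixes L :: "'v::euclidean_space \<Rightarrow> 'v \<Rightarrow> 'v \<Rightarrow> real"
  assumes pq: "p > 1" "1 / p + 1 / q = 1"
    and L: "selfdual_Lagrangian \<Omega> (\<lambda>x a b. ereal (L x a b))" and growth: "pq_growth \<Omega> p q L"
  shows "vector_field (\<lambda>x a b. ereal (L x a b)) \<in> M_class \<Omega> p q"
proof -
  let ?\<beta> = "vector_field (\<lambda>x a b. ereal (L x a b))"
  let ?l = "\<lambda>x z. L x (fst z) (snd z)"
  from L have meas: "(\<lambda>y. ?l (fst y) (snd y)) \<in> borel_measurable (lebesgue_on \<Omega> \<Otimes>\<^sub>M borel)"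
    and sd: "\<And>x. x \<in> \<Omega> \<Longrightarrow> selfdual (?l x)"
    by (auto simp: selfdual_Lagrangian_real)
  have compact_case: "{(x, \<xi>). x \<in> \<Omega> \<and> ?\<beta> x \<xi> \<inter> C \<noteq> {}} \<in> sets (lebesgue_on \<Omega> \<Otimes>\<^sub>M borel)"
    if C: "compact C" for C
  proof -
    obtain D where D: "countable D" "D \<subseteq> C" "C \<subseteq> closure D"
      by (rule separable)
    define T where "T k \<eta> = {y \<in> space (lebesgue_on \<Omega> \<Otimes>\<^sub>M (borel :: 'v measure)).
      L (fst y) (snd y) \<eta> - snd y \<bullet> \<eta> < 1 / Suc k}" for k \<eta>
    have "T k \<eta> \<in> sets (lebesgue_on \<Omega> \<Otimes>\<^sub>M borel)" for k \<eta>
    proof -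
      have "(\<lambda>y. (\<lambda>y. ?l (fst y) (snd y)) (fst y, (snd y, \<eta>))) \<in> borel_measurable (lebesgue_on \<Omega> \<Otimes>\<^sub>M (borel :: 'v measure))"
      proof (rule measurable_compose[OF _ meas])
        show "(\<lambda>y. (fst y, (snd y, \<eta>))) \<in> lebesgue_on \<Omega> \<Otimes>\<^sub>M (borel :: 'v measure) \<rightarrow>\<^sub>M lebesgue_on \<Omega> \<Otimes>\<^sub>M borel"
          unfolding borel_prod[symmetric] by measurable
      qed
      then have [measurable]: "(\<lambda>y. L (fst y) (snd y) \<eta>) \<in> borel_measurable (lebesgue_on \<Omega> \<Otimes>\<^sub>M (borel :: 'v measure))"
        by simp
      show ?thesis unfolding T_def by measurable
    qed
    then have "(\<Inter>k. \<Union>\<eta>\<in>D. T k \<eta>) \<in> sets (lebesgue_on \<Omega> \<Otimes>\<^sub>M borel)"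
      using D(1) by (intro sets.countable_INT sets.countable_UN') auto
    also have "(\<Inter>k. \<Union>\<eta>\<in>D. T k \<eta>) = {(x, \<xi>). x \<in> \<Omega> \<and> ?\<beta> x \<xi> \<inter> C \<noteq> {}}"
    proof (intro set_eqI)
      fix y :: "'v \<times> 'v"
      obtain x \<xi> where y: "y = (x, \<xi>)" by (cases y)
      show "y \<in> (\<Inter>k. \<Union>\<eta>\<in>D. T k \<eta>) \<longleftrightarrow> y \<in> {(x, \<xi>). x \<in> \<Omega> \<and> ?\<beta> x \<xi> \<inter> C \<noteq> {}}"
      proof (cases "x \<in> \<Omega>")
        case False
        then show ?thesis by (simp add: y T_def space_pair_measure)
      next
        case True
        define g where "g = (\<lambda>\<eta>. L x \<xi> \<eta> - \<xi> \<bullet> \<eta>)"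
        have g0: "0 \<le> g \<eta>" for \<eta>
          using selfdual_ge_coupling[OF sd[OF True], of "(\<xi>, \<eta>)"] by (simp add: g_def coupling_def)
        have "continuous_on UNIV (\<lambda>\<eta>. ?l x (\<xi>, \<eta>))"
          by (rule continuous_on_compose2[OF selfdual_continuous[OF sd[OF True]]]) (auto intro!: continuous_intros)
        then have cont: "continuous_on UNIV g"
          unfolding g_def by (intro continuous_intros) simp
        have "(\<forall>k. \<exists>\<eta>\<in>D. g \<eta> < 1 / Suc k) \<longleftrightarrow> (\<exists>\<eta>\<in>C. g \<eta> = 0)"
        proof
          assume "\<forall>k. \<exists>\<eta>\<in>D. g \<eta> < 1 / Suc k"
          then have small: "\<exists>\<eta>\<in>C. g \<eta> < 1 / Suc k" for k using D(2) by blast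
          then have "C \<noteq> {}" by blast
          then obtain \<eta> where \<eta>: "\<eta> \<in> C" "\<And>\<eta>'. \<eta>' \<in> C \<Longrightarrow> g \<eta> \<le> g \<eta>'"
            using continuous_attains_inf[OF C _ continuous_on_subset[OF cont subset_UNIV]] by blast
          have "g \<eta> = 0"
          proof (rule ccontr)
            assume "g \<eta> \<noteq> 0"
            then have "0 < g \<eta>" using g0[of \<eta>] by simp
            then obtain k where "1 / Suc k < g \<eta>" using nat_approx_posE by blast
            with small[of k] \<eta>(2) show False by fastforce
          qed
          with \<eta>(1) show "\<exists>\<eta>\<in>C. g \<eta> = 0" by blast
        next
          assume "\<exists>\<eta>\<in>C. g \<eta> = 0"
          then obtain \<eta> where \<eta>: "\<eta> \<in> C" "g \<eta> = 0" by blast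
          show "\<forall>k. \<exists>\<eta>\<in>D. g \<eta> < 1 / Suc k"
          proof
            fix k
            have "open {\<eta>. g \<eta> < 1 / Suc k}"
              by (intro open_Collect_less cont continuous_intros)
            moreover have "\<eta> \<in> {\<eta>. g \<eta> < 1 / Suc k} \<inter> closure D" using \<eta> D(3) by auto
            ultimately have "{\<eta>. g \<eta> < 1 / Suc k} \<inter> D \<noteq> {}"
              by (metis empty_iff open_Int_closure_eq_empty)
            then show "\<exists>\<eta>\<in>D. g \<eta> < 1 / Suc k" by blast
          qed
        qed
        then show ?thesis
          using True by (auto simp: y T_def space_pair_measure g_def vector_field_def)
      qed
    qed
    finally show ?thesis .
  qed
  have "measurable_multimap \<Omega> ?\<beta>"
    unfolding measurable_multimap_def
  proof (intro allI impI)
    fix C :: "'v set" assume C: "closed C"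
    have "(\<Union>n::nat. {(x, \<xi>). x \<in> \<Omega> \<and> ?\<beta> x \<xi> \<inter> (C \<inter> cball 0 n) \<noteq> {}}) \<in> sets (lebesgue_on \<Omega> \<Otimes>\<^sub>M borel)"
      by (intro sets.countable_UN image_subsetI compact_case closed_Int_compact C compact_cball)
    also have "(\<Union>n::nat. {(x, \<xi>). x \<in> \<Omega> \<and> ?\<beta> x \<xi> \<inter> (C \<inter> cball 0 n) \<noteq> {}})
        = {(x, \<xi>). x \<in> \<Omega> \<and> ?\<beta> x \<xi> \<inter> C \<noteq> {}}"
    proof -
      have "\<exists>n::nat. \<eta> \<in> cball 0 (real n)" for \<eta> :: 'v
        using real_arch_simple[of "norm \<eta>"] by simp
      then show ?thesis by blast
    qed
    finally show "{(x, \<xi>). x \<in> \<Omega> \<and> ?\<beta> x \<xi> \<inter> C \<noteq> {}} \<in> sets (lebesgue_on \<Omega> \<Otimes>\<^sub>M borel)" .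
  qed
  moreover have "closed (?\<beta> x \<xi>)" if "x \<in> \<Omega>" for x \<xi>
    unfolding vector_field_eq by (rule closed_touching_fibre[OF sd[OF that]])
  moreover have "AE x in lebesgue_on \<Omega>. maximal_monotone_map (?\<beta> x)"
  proof (rule AE_I2)
    fix x assume "x \<in> space (lebesgue_on \<Omega>)"
    then have "selfdual (?l x)" by (simp add: sd)
    from maximal_monotone_map_touching[OF this]
    show "maximal_monotone_map (?\<beta> x)" by (simp add: vector_field_eq[abs_def])
  qed
  moreover have "\<exists>c1 c2. \<exists>m1 m2 :: 'v \<Rightarrow> real.
        c1 > 0 \<and> c2 > 0 \<and>
        integrable (lebesgue_on \<Omega>) m1 \<and> integrable (lebesgue_on \<Omega>) m2 \<and>
        (\<forall>x\<in>\<Omega>. 0 \<le> m1 x \<and> 0 \<le> m2 x) \<and>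
        (AE x in lebesgue_on \<Omega>. \<forall>\<xi>. \<forall>\<eta>\<in>?\<beta> x \<xi>.
           \<xi> \<bullet> \<eta> \<ge> max (c1 / p * norm \<xi> powr p - m1 x) (c2 / q * norm \<eta> powr q - m2 x))"
  proof -
    from growth obtain C0 n0 where C0: "C0 > 0" "integrable (lebesgue_on \<Omega>) n0"
      "\<And>x a b. x \<in> \<Omega> \<Longrightarrow> C0 * (norm a powr p + norm b powr q - n0 x) \<le> L x a b"
      unfolding pq_growth_def by blast
    note q = conjugate_exponent_gt_1[OF pq]
    define m where "m = (\<lambda>x. C0 * \<bar>n0 x\<bar>)"
    have m: "integrable (lebesgue_on \<Omega>) m" unfolding m_def using C0(2) by simp
    have "AE x in lebesgue_on \<Omega>. \<forall>\<xi>. \<forall>\<eta>\<in>?\<beta> x \<xi>.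
           \<xi> \<bullet> \<eta> \<ge> max (p * C0 / p * norm \<xi> powr p - m x) (q * C0 / q * norm \<eta> powr q - m x)"
    proof (intro AE_I2 allI ballI)
      fix x \<xi> \<eta> assume "x \<in> space (lebesgue_on \<Omega>)" and \<eta>: "\<eta> \<in> ?\<beta> x \<xi>"
      then have "C0 * (norm \<xi> powr p + norm \<eta> powr q - n0 x) \<le> \<xi> \<bullet> \<eta>"
        using C0(3)[of x \<xi> \<eta>] by (simp add: vector_field_def)
      moreover have "C0 * n0 x \<le> m x" using C0(1) by (simp add: m_def)
      moreover have "0 \<le> C0 * norm \<xi> powr p" "0 \<le> C0 * norm \<eta> powr q" using C0(1) by simp_all
      ultimately show "\<xi> \<bullet> \<eta> \<ge> max (p * C0 / p * norm \<xi> powr p - m x) (q * C0 / q * norm \<eta> powr q - m x)"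
        using pq q by (simp add: algebra_simps)
    qed
    moreover have "p * C0 > 0" "q * C0 > 0" "\<forall>x\<in>\<Omega>. 0 \<le> m x \<and> 0 \<le> m x"
      using pq q C0(1) by (simp_all add: m_def)
    ultimately show ?thesis using m by blast
  qed
  ultimately show ?thesis unfolding M_class_def by blast
qed

text \<open>On the null set where \<open>\<beta>(x,\<cdot>)\<close> fails to be maximal monotone or coercive, the set of pairs from which the
  Lagrangian is built is replaced by \<open>{(0, 0)}\<close>, which is monotone and coercive too. The
  origin is put into the dense set because the pair \<open>(0, s\<^sub>0(x))\<close> has coupling zero; coercivity then
  bounds it by a multiple of \<open>m(x)\<close>, which keeps the growth function integrable.\<close>

theorem M_class_selfdual_Lagrangian:
  fixes \<beta> :: "'v::euclidean_space \<Rightarrow> 'v \<Rightarrow> 'v set"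
  assumes pq: "p > 1" "1 / p + 1 / q = 1" and \<beta>: "\<beta> \<in> M_class \<Omega> p q"
  shows "\<exists>L :: 'v \<Rightarrow> 'v \<Rightarrow> 'v \<Rightarrow> real. selfdual_Lagrangian \<Omega> (\<lambda>x a b. ereal (L x a b)) \<and>
    (AE x in lebesgue_on \<Omega>. \<beta> x = vector_field (\<lambda>x a b. ereal (L x a b)) x) \<and> pq_growth \<Omega> p q L"
proof -
  let ?M = "lebesgue_on \<Omega>"
  note q = conjugate_exponent_gt_1[OF pq]
  have meas: "measurable_multimap \<Omega> \<beta>"
    and max: "AE x in ?M. maximal_monotone_map (\<beta> x)"
    and "\<exists>c1 c2. \<exists>m1 m2 :: 'v \<Rightarrow> real. c1 > 0 \<and> c2 > 0 \<and> integrable ?M m1 \<and> integrable ?M m2 \<and>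
        (\<forall>x\<in>\<Omega>. 0 \<le> m1 x \<and> 0 \<le> m2 x) \<and>
        (AE x in ?M. \<forall>\<xi>. \<forall>\<eta>\<in>\<beta> x \<xi>.
           \<xi> \<bullet> \<eta> \<ge> max (c1 / p * norm \<xi> powr p - m1 x) (c2 / q * norm \<eta> powr q - m2 x))"
    using \<beta> unfolding M_class_def mem_Collect_eq by (elim conjE; simp)+
  then obtain c1 c2 and m1 m2 :: "'v \<Rightarrow> real" where c12: "c1 > 0" "c2 > 0"
    and m12: "integrable ?M m1" "integrable ?M m2" "\<forall>x\<in>\<Omega>. 0 \<le> m1 x \<and> 0 \<le> m2 x"
    and coer: "AE x in ?M. \<forall>\<xi>. \<forall>\<eta>\<in>\<beta> x \<xi>.
           \<xi> \<bullet> \<eta> \<ge> max (c1 / p * norm \<xi> powr p - m1 x) (c2 / q * norm \<eta> powr q - m2 x)"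
    by (elim exE conjE)
  \<comment> \<open>the average of the two coercivity bounds; the sum of the \<open>m\<^sub>i\<close> dominates their average\<close>
  define c where "c = min (c1 / p) (c2 / q) / 2"
  define m where "m = (\<lambda>x. m1 x + m2 x)"
  have c: "c > 0" using c12 pq q by (simp add: c_def)
  have m: "0 \<le> m x" if "x \<in> \<Omega>" for x using m12(3) that by (simp add: m_def)
  define good where "good x \<longleftrightarrow> maximal_monotone_map (\<beta> x) \<and>
    (\<forall>\<xi>. \<forall>\<eta>\<in>\<beta> x \<xi>. c * pnorm p q (\<xi>, \<eta>) - m x \<le> \<xi> \<bullet> \<eta>)" for x
  have "AE x in ?M. good x"
    using max coer AE_space
  proof eventually_elim
    case (elim x)
    have "c * pnorm p q (\<xi>, \<eta>) - m x \<le> \<xi> \<bullet> \<eta>" if "\<eta> \<in> \<beta> x \<xi>" for \<xi> \<eta>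
    proof -
      have "2 * c * norm \<xi> powr p \<le> c1 / p * norm \<xi> powr p" "2 * c * norm \<eta> powr q \<le> c2 / q * norm \<eta> powr q"
        by (intro mult_right_mono; simp add: c_def)+
      moreover have "c1 / p * norm \<xi> powr p - m1 x \<le> \<xi> \<bullet> \<eta>" "c2 / q * norm \<eta> powr q - m2 x \<le> \<xi> \<bullet> \<eta>"
        using elim(2) that by auto
      moreover have "0 \<le> m1 x" "0 \<le> m2 x" using m12(3) elim(3) by auto
      ultimately show ?thesis unfolding pnorm_def m_def fst_conv snd_conv distrib_left by linarith
    qed
    with elim(1) show ?case by (simp add: good_def)
  qed
  then obtain N where N: "{x \<in> space ?M. \<not> good x} \<subseteq> N" "emeasure ?M N = 0" "N \<in> sets ?M"
    by (rule AE_E)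
  define G where "G = space ?M - N"
  have G [measurable]: "G \<in> sets ?M" unfolding G_def by (rule sets.Diff[OF sets.top N(3)])
  have AE_G: "AE x in ?M. x \<in> G"
    using N by (intro AE_I[of _ _ N]) (auto simp: G_def)
  have "\<exists>l. selfdual l \<and> touching_set l = {z. snd z \<in> \<beta> x (fst z)}" if "x \<in> G" for x
  proof -
    have "good x" using N(1) that by (auto simp: G_def)
    then show ?thesis unfolding good_def by (intro maximal_coercive_eq_touching[OF pq c]) auto
  qed
  then obtain k where k: "\<And>x. x \<in> G \<Longrightarrow> selfdual (k x)"
    "\<And>x. x \<in> G \<Longrightarrow> touching_set (k x) = {z. snd z \<in> \<beta> x (fst z)}" by metis
  have fibre: "\<beta> x \<xi> = {b. (\<xi>, b) \<in> touching_set (k x)}" if "x \<in> G" for x \<xi>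
    using k(2)[OF that] by simp
  have good_fibre: "closed (\<beta> x \<xi>) \<and> convex (\<beta> x \<xi>) \<and> \<beta> x \<xi> \<noteq> {}" if "x \<in> G" for x \<xi>
    using touching_full_domain[OF k(1)[OF that], of \<xi>]
    unfolding fibre[OF that] by (auto intro: closed_touching_fibre convex_touching_fibre k(1)[OF that])
  obtain D0 :: "'v set" where D0: "countable D0" "\<And>U. open U \<Longrightarrow> U \<noteq> {} \<Longrightarrow> \<exists>d\<in>D0. d \<in> U"
    by (rule countable_dense_setE) blast
  define D where "D = insert 0 D0"
  have D: "countable D" "D \<noteq> {}" "0 \<in> D" using D0(1) by (auto simp: D_def)
  have dense: "closure D = UNIV"
  proof -
    have "closure D \<inter> U \<noteq> {}" if "open U" "U \<noteq> {}" for U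
      using D0(2)[OF that] closure_subset[of D] by (auto simp: D_def)
    from this[of "- closure D"] show ?thesis by auto
  qed
  define s where "s d x = (if x \<in> G then closest_point (\<beta> x d) 0 else 0)" for d x
  have s_meas [measurable]: "s d \<in> borel_measurable ?M" for d
    unfolding s_def
  proof (rule measurable_closest_point[OF _ G])
    show "closed (\<beta> x d) \<and> convex (\<beta> x d) \<and> \<beta> x d \<noteq> {}" if "x \<in> G" for x by (rule good_fibre[OF that])
    fix C :: "'v set" assume "closed C"
    then have "{(x, \<xi>). x \<in> \<Omega> \<and> \<beta> x \<xi> \<inter> C \<noteq> {}} \<in> sets (?M \<Otimes>\<^sub>M borel)"
      using meas by (simp add: measurable_multimap_def)
    from sets_Pair2[OF this, of d] show "{x \<in> space ?M. \<beta> x d \<inter> C \<noteq> {}} \<in> sets ?M"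
      by (simp add: vimage_def)
  qed
  define \<zeta> where "\<zeta> d x = (if x \<in> G then (d, s d x) else (0, 0))" for d x
  have \<zeta>_meas: "\<zeta> d \<in> borel_measurable ?M" for d
    unfolding \<zeta>_def borel_prod[symmetric] by measurable
  define A where "A x = (\<lambda>d. \<zeta> d x) ` D" for x
  have s_in: "s d x \<in> \<beta> x d" if "x \<in> G" for d x
    using good_fibre[OF that, of d] that by (simp add: s_def closest_point_in_set)
  have A: "coercive_monotone p q c (m x) (A x)" if "x \<in> \<Omega>" for x
  proof (cases "x \<in> G")
    case True
    have "good x" using N(1) True by (auto simp: G_def)
    moreover have "snd z \<in> \<beta> x (fst z)" if "z \<in> A x" for z
      using that s_in[OF True] True by (auto simp: A_def \<zeta>_def)
    ultimately show ?thesis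
      unfolding coercive_monotone_def good_def maximal_monotone_map_def monotone_map_iff
      by (auto simp: coupling_def)
  next
    case False
    then have 0: "z = 0" if "z \<in> A x" for z
      using that by (auto simp: A_def \<zeta>_def zero_prod_def)
    have c0: "coupling (0 :: 'v \<times> 'v) = 0" "pnorm p q (0 :: 'v \<times> 'v) = 0"
      using pq q by (simp_all add: coupling_def pnorm_def)
    show ?thesis
      unfolding coercive_monotone_def
    proof (intro conjI ballI)
      fix z w assume "z \<in> A x" "w \<in> A x"
      then have "z = 0" "w = 0" by (simp_all only: 0)
      then show "0 \<le> coupling (z - w)" by (simp add: c0)
    next
      fix z assume "z \<in> A x"
      then have "z = 0" by (rule 0)
      then show "c * pnorm p q z - m x \<le> coupling z" using m[OF that] by (simp add: c0)
    qed
  qed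
  have ne: "A x \<noteq> {}" for x using D by (simp add: A_def)
  define l where "l x = selfdual_below (prox_mean p q (A x))" for x
  have sd: "selfdual (l x)" and sub: "A x \<subseteq> touching_set (l x)" if "x \<in> \<Omega>" for x
    unfolding l_def using selfdual_extension[OF pq c A[OF that] ne] .
  have "(\<lambda>y. l (fst y) (snd y)) \<in> borel_measurable (?M \<Otimes>\<^sub>M borel)"
    unfolding l_def
  proof (rule measurable_selfdual_below)
    show "subdual (prox_mean p q (A x))" if "x \<in> space ?M" for x
      using that by (intro subdual_prox_mean[OF pq c A ne]) simp
    show "usc (prox_mean p q (A x))" if "x \<in> space ?M" for x
      using that by (intro usc_prox_mean[OF pq c A ne]) simp
    show "(\<lambda>y. prox_mean p q (A (fst y)) (snd y)) \<in> borel_measurable (?M \<Otimes>\<^sub>M borel)"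
      unfolding A_def using A
      by (intro measurable_prox_mean[OF pq c D(1,2) \<zeta>_meas, where m = m]) (simp add: A_def)
  qed
  then have Lagr: "selfdual_Lagrangian \<Omega> (\<lambda>x a b. ereal (l x (a, b)))"
    unfolding selfdual_Lagrangian_real using sd by simp
  have "AE x in ?M. \<beta> x = vector_field (\<lambda>x a b. ereal (l x (a, b))) x"
    using AE_G AE_space
  proof eventually_elim
    case (elim x)
    then have x: "x \<in> \<Omega>" by simp
    have "touching_set (l x) = touching_set (k x)"
    proof (rule touching_eq_of_dense[OF k(1)[OF elim(1)] sd[OF x] dense])
      fix d assume "d \<in> D"
      then have "(d, s d x) \<in> A x" using elim(1) by (auto simp: A_def \<zeta>_def)
      then show "(d, s d x) \<in> touching_set (k x) \<inter> touching_set (l x)"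
        using sub[OF x] s_in[OF elim(1), of d] k(2)[OF elim(1)] by auto
    qed
    then show ?case using fibre[OF elim(1)] by (auto simp: vector_field_eq fun_eq_iff)
  qed
  moreover have "pq_growth \<Omega> p q (\<lambda>x a b. l x (a, b))"
  proof -
    obtain C1 where C1: "C1 > 0" "\<And>(A :: ('v \<times> 'v) set) m w z. 0 \<le> m \<Longrightarrow> coercive_monotone p q c m A \<Longrightarrow>
        w \<in> A \<Longrightarrow> prox_mean p q A z \<le> C1 * (pnorm p q z + (pnorm p q w + m))"
      using prox_mean_growth[OF pq c] by blast
    obtain C0 where C0: "C0 > 0" "\<And>(l :: 'v \<times> 'v \<Rightarrow> real) n z. selfdual l \<Longrightarrow>
        (\<And>z. l z \<le> C1 * (pnorm p q z + n)) \<Longrightarrow> C0 * pnorm p q z - C1 * n \<le> l z"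
      using selfdual_lower_growth[OF pq C1(1)] by blast
    define n where "n = (\<lambda>x. m x / c + m x)"
    have up: "l x z \<le> C1 * (pnorm p q z + n x)" if x: "x \<in> \<Omega>" for x z
    proof -
      define w where "w = \<zeta> 0 x"
      have w: "w \<in> A x" using D(3) by (auto simp: A_def w_def)
      have "coupling w = 0" by (simp add: w_def \<zeta>_def coupling_def)
      then have "c * pnorm p q w \<le> m x" using A[OF x] w unfolding coercive_monotone_def by fastforce
      then have "pnorm p q w \<le> m x / c" using c by (simp add: field_simps)
      have "l x z \<le> prox_mean p q (A x) z"
        unfolding l_def by (rule selfdual_below_le[OF subdual_prox_mean[OF pq c A[OF x] ne]])
      also have "\<dots> \<le> C1 * (pnorm p q z + (pnorm p q w + m x))"
        by (rule C1(2)[OF m[OF x] A[OF x] w])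
      also have "\<dots> \<le> C1 * (pnorm p q z + n x)"
        using C1(1) \<open>pnorm p q w \<le> m x / c\<close> by (simp add: n_def)
      finally show ?thesis .
    qed
    have low: "C0 * (pnorm p q z - C1 / C0 * n x) \<le> l x z" if x: "x \<in> \<Omega>" for x z
      using C0(2)[OF sd[OF x] up[OF x], of z] C0(1) by (simp add: algebra_simps)
    have n: "integrable ?M n" "integrable ?M (\<lambda>x. C1 / C0 * n x)"
      unfolding n_def m_def using m12 by auto
    show ?thesis
      unfolding pq_growth_def
    proof (rule exI[of _ C0], rule exI[of _ C1], rule exI[of _ "\<lambda>x. C1 / C0 * n x"], rule exI[of _ n],
        intro conjI ballI allI)
      fix x a b assume x: "x \<in> \<Omega>"
      show "C0 * (norm a powr p + norm b powr q - C1 / C0 * n x) \<le> l x (a, b)"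
        using low[OF x, of "(a, b)"] by (simp add: pnorm_def)
      show "l x (a, b) \<le> C1 * (norm a powr p + norm b powr q + n x)"
        using up[OF x, of "(a, b)"] by (simp add: pnorm_def)
    qed (use C0(1) C1(1) n in auto)
  qed
  ultimately show ?thesis using Lagr by (intro exI[of _ "\<lambda>x a b. l x (a, b)"]) simp
qed

theorem proposition3p1:
  fixes \<Omega> :: "(real ^ 'n) set" and p q :: real
  assumes "open \<Omega>" and "connected \<Omega>" and "\<Omega> \<noteq> {}"
    and "p > 1" and "1 / p + 1 / q = 1"
  shows "(\<forall>\<beta> \<in> M_class \<Omega> p q.
            \<exists>L :: real ^ 'n \<Rightarrow> real ^ 'n \<Rightarrow> real ^ 'n \<Rightarrow> real.
              selfdual_Lagrangian \<Omega> (\<lambda>x a b. ereal (L x a b)) \<and>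
              (AE x in lebesgue_on \<Omega>. \<beta> x = vector_field (\<lambda>x a b. ereal (L x a b)) x) \<and>
              pq_growth \<Omega> p q L) \<and>
         (\<forall>L :: real ^ 'n \<Rightarrow> real ^ 'n \<Rightarrow> real ^ 'n \<Rightarrow> real.
              selfdual_Lagrangian \<Omega> (\<lambda>x a b. ereal (L x a b)) \<and> pq_growth \<Omega> p q L \<longrightarrow>
              vector_field (\<lambda>x a b. ereal (L x a b)) \<in> M_class \<Omega> p q)"
  using M_class_selfdual_Lagrangian[OF assms(4,5)] vector_field_in_M_class[OF assms(4,5)] by blast

end
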